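(* Assume that $G:\mathbb{R}\times X\times X\to X$ is continuous, that $p:\mathbb{R}\times X\to X$ satisfies $\|p(t,u)-p(s,v)\|\le L_p(|s-t|+\|u-v\|)$ for some $L_p\ge0$ and $\|p(s,u)\|\le C_1\|u\|+C_2$ for some $C_1,C_2\ge0$ and all $(t,u),(s,v)\in\mathbb{R}\times X$, and that (A1), (A2), (A3) hold. Then for every $\varphi\in C$ the initial value problem $\frac{du(t)}{dt}+Au(t)=B(t,u_t)$, $t\ge a$, $u_a=\varphi$, possesses a mild solution (on $[a-r,T]$ for some $T>a$).
   Context: Let $X$ be a Banach space with norm $\|\cdot\|$, $r>0$, $a\in\mathbb{R}$, and $C=C([-r,0];X)$ with the supremum norm $\|\cdot\|_C$. For a continuous $u:[a-r,b]\to X$ and $t\in[a,b]$, $u_t\in C$ denotes $u_t(\theta)=u(t+\theta)$, $\theta\in[-r,0]$. Let $A$ be the infinitesimal generator of a compact $C_0$-semigroup $\{e^{-At}\}_{t\ge0}$ on $X$ with $\|e^{-At}\|\le e^{\omega t}$ for all $t\ge0$, for a fixed $\omega\in\mathbb{R}$. The nonlinearity is $B(t,\psi)=G(t,\psi(0),F(t,\psi))$ with $F(t,\psi)=\int_{-r}^0 p(t,\psi(\theta))\,dg(\theta,t,\psi)$ (Stieltjes integral in $\theta$), where $g:[-r,0]\times\mathbb{R}\times C\to\mathbb{R}$. (A1): for every $(t,\varphi)$, $g(\cdot,t,\varphi)$ has bounded variation on $[-r,0]$ and $V_{-r}^0g(\cdot,t,\varphi)\le M_{Vg}$ for a constant $M_{Vg}>0$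 independent of $(t,\varphi)$. Write $g=g_d+g_c$, where $g_d(\cdot,t,\varphi)$ is the jump (step-function) part and $g_c=g_{ac}+g_s$ the continuous part (absolutely continuous plus singular continuous) of $g(\cdot,t,\varphi)$. (A2): for each $\theta\in[-r,0]$, $(t,\varphi)\mapsto g_c(\theta,t,\varphi)$ is continuous on $\mathbb{R}\times C$. (A3): the jump points of $g_d(\cdot,t,\varphi)$ are $\theta_k=-\eta_k(t,\varphi)$ with jumps $h_k(t,\varphi)=g_d(\theta_k+0,t,\varphi)-g_d(\theta_k-0,t,\varphi)$, where $\eta_k:\mathbb{R}\times C\to[0,r]$, $h_k:\mathbb{R}\times C\to\mathbb{R}$ are continuous, and $\sum_k h_k(t,\varphi)$ converges absolutely and uniformly on bounded subsets of $\mathbb{R}\times C$. A mild solution on $[a-r,T]$ is a function $u\in C([a-r,T];X)$ with $u_a=\varphi$ and $u(t)=e^{-A(t-a)}\varphi(0)+\int_a^t e^{-A(t-s)}B(s,u_s)\,ds$ for $t\in[a,T]$. *)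

theory Defs
  imports "HOL-Analysis.Analysis"
begin

text \<open>An element of C([-r,0];X) is represented as a bounded continuous function on the whole
real line which is constant to the left of -r and to the right of 0 (i.e. it is the
unique extension by the endpoint values).  With the sup norm of the type bcontfun this
is an isometric copy of C([-r,0];X) with the supremum norm.\<close>

definition clamp :: "real \<Rightarrow> real \<Rightarrow> real" where
  "clamp r \<theta> = max (-r) (min 0 \<theta>)"

definition Cspace :: "real \<Rightarrow> (real \<Rightarrow>\<^sub>C 'a::real_normed_vector) set" where
  "Cspace r = {\<phi>. \<forall>\<theta>. apply_bcontfun \<phi> \<theta> = apply_bcontfun \<phi> (clamp r \<theta>)}"

definition hist :: "real \<Rightarrow> (real \<Rightarrow> 'a::real_normed_vector) \<Rightarrow> real \<Rightarrow> (real \<Rightarrow>\<^sub>C 'a)" where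
  "hist r u t = Bcontfun (\<lambda>\<theta>. u (t + clamp r \<theta>))"

definition is_partition :: "real \<Rightarrow> real \<Rightarrow> nat \<Rightarrow> (nat \<Rightarrow> real) \<Rightarrow> bool" where
  "is_partition a b n x \<longleftrightarrow> x 0 = a \<and> x n = b \<and> (\<forall>i<n. x i \<le> x (Suc i))"

definition total_variation :: "(real \<Rightarrow> real) \<Rightarrow> real \<Rightarrow> real \<Rightarrow> ereal" where
  "total_variation f a b =
     (SUP (n, x) \<in> {(n, x). is_partition a b n x}.
        ereal (\<Sum>i<n. \<bar>f (x (Suc i)) - f (x i)\<bar>))"

definition bounded_variation_on :: "(real \<Rightarrow> real) \<Rightarrow> real \<Rightarrow> real \<Rightarrow> bool" where
  "bounded_variation_on f a b \<longleftrightarrow> total_variation f a b < \<infinity>"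

definition has_RS_integral ::
  "(real \<Rightarrow> 'a::real_normed_vector) \<Rightarrow> (real \<Rightarrow> real) \<Rightarrow> real \<Rightarrow> real \<Rightarrow> 'a \<Rightarrow> bool" where
  "has_RS_integral f g a b I \<longleftrightarrow>
     (\<forall>e>0. \<exists>\<delta>>0. \<forall>n x \<xi>.
        is_partition a b n x \<and> (\<forall>i<n. x i \<le> \<xi> i \<and> \<xi> i \<le> x (Suc i) \<and> x (Suc i) - x i < \<delta>)
        \<longrightarrow> norm ((\<Sum>i<n. (g (x (Suc i)) - g (x i)) *\<^sub>R f (\<xi> i)) - I) < e)"

definition RS_integral :: "(real \<Rightarrow> 'a::real_normed_vector) \<Rightarrow> (real \<Rightarrow> real) \<Rightarrow> real \<Rightarrow> real \<Rightarrow> 'a" where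
  "RS_integral f g a b = (THE I. has_RS_integral f g a b I)"

text \<open>One-sided limits inside [a,b], with the conventions f(a-0) = f(a), f(b+0) = f(b).\<close>
definition rlim :: "(real \<Rightarrow> real) \<Rightarrow> real \<Rightarrow> real \<Rightarrow> real" where
  "rlim f b x = (if x \<ge> b then f x else Lim (at_right x) f)"

definition llim :: "(real \<Rightarrow> real) \<Rightarrow> real \<Rightarrow> real \<Rightarrow> real" where
  "llim f a x = (if x \<le> a then f x else Lim (at_left x) f)"

definition jump :: "(real \<Rightarrow> real) \<Rightarrow> real \<Rightarrow> real \<Rightarrow> real \<Rightarrow> real" where
  "jump f a b x = rlim f b x - llim f a x"

text \<open>The jump (saltus) function of f on [a,b]:
  s(a) = 0, and for a < x \<le> b
  s(x) = [f(a+0) - f(a)] + \<Sum>_{a<y<x} [f(y+0) - f(y-0)] + [f(x) - f(x-0)].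
  Then f = s + (f - s) with f - s continuous; s is the jump part g_d and f - s the
  continuous part g_c = g_ac + g_s.\<close>
definition jump_part :: "(real \<Rightarrow> real) \<Rightarrow> real \<Rightarrow> real \<Rightarrow> real \<Rightarrow> real" where
  "jump_part f a b x =
     (if x \<le> a then 0
      else (rlim f b a - f a) + infsum (\<lambda>y. rlim f b y - llim f a y) {a<..<x}
           + (f x - llim f a x))"

definition cont_part :: "(real \<Rightarrow> real) \<Rightarrow> real \<Rightarrow> real \<Rightarrow> real \<Rightarrow> real" where
  "cont_part f a b x = f x - jump_part f a b x"

definition C0_semigroup :: "(real \<Rightarrow> ('a::banach \<Rightarrow>\<^sub>L 'a)) \<Rightarrow> bool" where
  "C0_semigroup S \<longleftrightarrow>
     S 0 = id_blinfun \<and>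
     (\<forall>t\<ge>0. \<forall>s\<ge>0. S (t + s) = S t o\<^sub>L S s) \<and>
     (\<forall>x. ((\<lambda>t. blinfun_apply (S t) x) \<longlongrightarrow> x) (at_right 0))"

definition compact_operator :: "('a::real_normed_vector \<Rightarrow>\<^sub>L 'b::real_normed_vector) \<Rightarrow> bool" where
  "compact_operator T \<longleftrightarrow> compact (closure (blinfun_apply T ` ball 0 1))"

definition compact_semigroup :: "(real \<Rightarrow> ('a::banach \<Rightarrow>\<^sub>L 'a)) \<Rightarrow> bool" where
  "compact_semigroup S \<longleftrightarrow> C0_semigroup S \<and> (\<forall>t>0. compact_operator (S t))"

text \<open>S t plays the role of e^{-At}.  u is a mild solution on [a-r,T] of
  du/dt + Au = B(t,u_t), u_a = \<phi>.\<close>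
definition mild_solution ::
  "(real \<Rightarrow> ('a::banach \<Rightarrow>\<^sub>L 'a)) \<Rightarrow> (real \<Rightarrow> (real \<Rightarrow>\<^sub>C 'a) \<Rightarrow> 'a) \<Rightarrow> real \<Rightarrow> real
     \<Rightarrow> (real \<Rightarrow>\<^sub>C 'a) \<Rightarrow> real \<Rightarrow> (real \<Rightarrow> 'a) \<Rightarrow> bool" where
  "mild_solution S B r a \<phi> T u \<longleftrightarrow>
     continuous_on {a - r..T} u \<and>
     (\<forall>\<theta>\<in>{-r..0}. u (a + \<theta>) = apply_bcontfun \<phi> \<theta>) \<and>
     (\<forall>t\<in>{a..T}. ((\<lambda>s. blinfun_apply (S (t - s)) (B s (hist r u s)))
                    has_integral (u t - blinfun_apply (S (t - a)) (apply_bcontfun \<phi> 0))) {a..t})"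

end

theory Submission
  imports Defs
begin

text \<open>
  Continuity of \<open>B\<close>. Splitting \<open>g\<close> into its jump part and its continuous part splits the Stieltjes
  integral \<open>F\<close>. The jump part contributes \<open>\<Sum>k. h\<^sub>k(t,\<psi>) p(t, \<psi>(-\<eta>\<^sub>k(t,\<psi>)))\<close>, a locally uniformly
  convergent series of continuous functions. The integral against the continuous part is, by the
  uniform bound on the variation, approximated by Stieltjes sums over a fixed partition uniformly
  in \<open>(t,\<psi>)\<close>, and these sums depend continuously on \<open>(t,\<psi>)\<close> by (A2).

  Existence. After a truncation \<open>B\<close> may be assumed bounded. Replacing \<open>u\<^sub>s\<close> by \<open>u\<^bsub>s-\<delta>\<^esub>\<close> in the equation
  makes it explicitly solvable, step by step on intervals of length \<open>\<delta>\<close> (Tonelli). Compactness of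
  \<open>S h\<close> for \<open>h > 0\<close> puts all values of the convolutions \<open>\<integral> S(t-s) f(s) ds\<close> with \<open>f\<close> bounded by a fixed
  constant into one compact set, on which \<open>S h \<longlongrightarrow> id\<close> uniformly as \<open>h \<longlongrightarrow> 0\<close>; hence these convolutions are
  equicontinuous, and a subsequence of the approximate solutions converges uniformly
  as \<open>\<delta> \<longlongrightarrow> 0\<close> to a mild solution.
\<close>

section \<open>Riemann--Stieltjes integrals of continuous functions\<close>

text \<open>The splitting of \<open>g\<close> is forced by the moving jumps: at a fixed \<theta> the
  value of \<open>g\<close> need not depend continuously on (t,\<psi>), because a jump point can
  cross \<theta>, so Stieltjes sums of \<open>g\<close> itself over a fixed partition need not be
  continuous. In the jump part a moving location only moves the point at which a continuous
  integrand is evaluated. The continuous part needs a variation bound uniform in (t,\<psi>): the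
  jumps use up at most the variation of \<open>g\<close>, so the difference has at most twice the
  bound of (A1).

  \<open>B\<close> is continuous but not assumed Lipschitz, so no contraction argument applies.
  Balls of C need not be compact, so \<open>B\<close> may be unbounded or fail to be uniformly
  continuous on them. Hence the truncation is calibrated at the single point (a,\<phi>), the
  interval of existence is short, and the limit passage uses uniform continuity of \<open>B\<close>
  only around the compact curve s -> (s,u_s) of the limit. All approximants share the term S(t-a)
  \<phi>(0), so compactness is needed for the convolutions alone.\<close>

definition increments_le :: "(real \<Rightarrow> real) \<Rightarrow> (real \<Rightarrow> real) \<Rightarrow> real \<Rightarrow> real \<Rightarrow> bool" where
  "increments_le g v a b \<longleftrightarrow> (\<forall>x y. a \<le> x \<and> x \<le> y \<and> y \<le> b \<longrightarrow> \<bar>g y - g x\<bar> \<le> v y - v x)"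

lemma increments_leD:
  "increments_le g v a b \<Longrightarrow> a \<le> x \<Longrightarrow> x \<le> y \<Longrightarrow> y \<le> b \<Longrightarrow> \<bar>g y - g x\<bar> \<le> v y - v x"
  by (simp add: increments_le_def)

lemma increments_le_mono:
  "increments_le g v a b \<Longrightarrow> a \<le> x \<Longrightarrow> x \<le> y \<Longrightarrow> y \<le> b \<Longrightarrow> v x \<le> v y"
  using increments_leD[of g v a b x y] by linarith

text \<open>Dominating functions simply add, which is why an arbitrary \<open>v\<close> is carried
  along in place of the variation function of \<open>g\<close>: the estimates only use the number v
  b - v a.\<close>

lemma increments_le_diff:
  assumes "increments_le g v a b" "increments_le h w a b"
  shows "increments_le (\<lambda>x. g x - h x) (\<lambda>x. v x + w x) a b"
  unfolding increments_le_def
proof (intro allI impI)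
  fix x y assume "a \<le> x \<and> x \<le> y \<and> y \<le> b"
  then have "\<bar>g y - g x\<bar> \<le> v y - v x" "\<bar>h y - h x\<bar> \<le> w y - w x"
    using assms by (auto simp: increments_le_def)
  then show "\<bar>g y - h y - (g x - h x)\<bar> \<le> v y + w y - (v x + w x)" by linarith
qed

section \<open>Tagged partitions and comparison of Stieltjes sums\<close>

definition fine_tagged :: "real \<Rightarrow> real \<Rightarrow> real \<Rightarrow> nat \<Rightarrow> (nat \<Rightarrow> real) \<Rightarrow> (nat \<Rightarrow> real) \<Rightarrow> bool" where
  "fine_tagged a b \<delta> n x \<xi> \<longleftrightarrow> is_partition a b n x \<and>
     (\<forall>i<n. x i \<le> \<xi> i \<and> \<xi> i \<le> x (Suc i) \<and> x (Suc i) - x i < \<delta>)"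

definition RS_sum :: "(real \<Rightarrow> 'a::real_normed_vector) \<Rightarrow> (real \<Rightarrow> real) \<Rightarrow> nat \<Rightarrow> (nat \<Rightarrow> real)
    \<Rightarrow> (nat \<Rightarrow> real) \<Rightarrow> 'a" where
  "RS_sum f g n x \<xi> = (\<Sum>i<n. (g (x (Suc i)) - g (x i)) *\<^sub>R f (\<xi> i))"

lemma has_RS_integral_iff:
  "has_RS_integral f g a b I \<longleftrightarrow>
     (\<forall>e>0. \<exists>\<delta>>0. \<forall>n x \<xi>. fine_tagged a b \<delta> n x \<xi> \<longrightarrow> norm (RS_sum f g n x \<xi> - I) < e)"
  by (simp add: has_RS_integral_def fine_tagged_def RS_sum_def)

lemma has_RS_integralD:
  assumes "has_RS_integral f g a b I" "e > 0"
  obtains \<delta> where "\<delta> > 0" "\<And>n x \<xi>. fine_tagged a b \<delta> n x \<xi> \<Longrightarrow> norm (RS_sum f g n x \<xi> - I) < e"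
  using assms unfolding has_RS_integral_iff by blast

lemma fine_tagged_mono: "fine_tagged a b \<delta> n x \<xi> \<Longrightarrow> \<delta> \<le> \<delta>' \<Longrightarrow> fine_tagged a b \<delta>' n x \<xi>"
  unfolding fine_tagged_def by force

lemma is_partition_mono:
  assumes "is_partition a b n x" "i \<le> j" "j \<le> n"
  shows "x i \<le> x j"
  using assms(2,3)
proof (induction j rule: dec_induct)
  case (step m)
  then have "x m \<le> x (Suc m)" using assms(1) by (simp add: is_partition_def)
  with step show ?case by linarith
qed simp

lemma is_partition_bounds:
  assumes "is_partition a b n x" "i \<le> n"
  shows "a \<le> x i" "x i \<le> b"
  using is_partition_mono[OF assms(1), of 0 i] is_partition_mono[OF assms(1), of i n] assms
  by (auto simp: is_partition_def)

lemma fine_tagged_exists: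
  assumes "a < b" "\<delta> > 0"
  obtains n x where "fine_tagged a b \<delta> n x x" 
proof -
  obtain n :: nat where n: "(b - a) / \<delta> < real n" using reals_Archimedean2 by blast
  have n0: "real n > 0" using n assms by (smt (verit) divide_pos_pos)
  define x where "x i = a + real i * ((b - a) / real n)" for i
  have *: "x (Suc i) - x i = (b - a) / real n" for i by (simp add: x_def ring_distribs add_divide_distrib diff_divide_distrib)
  have "(b - a) / real n < \<delta>" using n n0 assms by (simp add: field_simps)
  moreover have "(b - a) / real n \<ge> 0" using assms by simp
  moreover have "x 0 = a" "x n = b" using n0 by (simp_all add: x_def)
  ultimately have "fine_tagged a b \<delta> n x x"
    unfolding fine_tagged_def is_partition_def using * by (smt (verit))
  then show thesis using that by blast
qed

lemma fine_tagged_exists2: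
  assumes "a < b" "\<delta> > 0" "\<delta>' > 0"
  obtains n x where "fine_tagged a b \<delta> n x x" "fine_tagged a b \<delta>' n x x"
proof -
  obtain n x where "fine_tagged a b (min \<delta> \<delta>') n x x" 
    using fine_tagged_exists[of a b "min \<delta> \<delta>'"] assms by auto
  then show thesis using that fine_tagged_mono by (meson min.cobounded1 min.cobounded2)
qed

definition clip :: "real \<Rightarrow> real \<Rightarrow> real \<Rightarrow> real" where "clip c d z = max c (min d z)"

text \<open>Each side is the increment of \<open>h\<close> over the intersection of [c,d] and [p,q],
  and 0 if they are disjoint. The symmetry allows a double family of such increments to be summed
  over either index.\<close>

lemma clip_increment_sym:
  "c \<le> d \<Longrightarrow> p \<le> q \<Longrightarrow> h (clip c d q) - h (clip c d p) = (h (clip p q d) - h (clip p q c) :: real)"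
  by (auto simp: clip_def max_def min_def)

text \<open>Both sums are written over the common refinement: the increment over the intersection
  of the \<open>i\<close>-th and the \<open>j\<close>-th interval is expressed through \<^const>\<open>clip\<close> and vanishes for
  disjoint intervals, so only tags at distance less than \<open>2\<delta>\<close> are ever compared.\<close>

lemma RS_sum_diff_le:
  fixes f :: "real \<Rightarrow> 'a::real_normed_vector"
  assumes P: "fine_tagged a b \<delta> n x \<xi>" and Q: "fine_tagged a b \<delta> m y \<zeta>"
    and g: "increments_le g v a b"
    and osc: "\<And>s t. s \<in> {a..b} \<Longrightarrow> t \<in> {a..b} \<Longrightarrow> \<bar>s - t\<bar> < 2 * \<delta> \<Longrightarrow> norm (f s - f t) \<le> e"
  shows "norm (RS_sum f g n x \<xi> - RS_sum f g m y \<zeta>) \<le> e * (v b - v a)"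
proof -
  have px: "is_partition a b n x" and py: "is_partition a b m y"
    using P Q by (auto simp: fine_tagged_def)
  have xe: "x 0 = a" "x n = b" and ye: "y 0 = a" "y m = b"
    using px py by (auto simp: is_partition_def)
  \<comment> \<open>\<open>h\<close> stays a variable: \<open>D g\<close> carries the weights of
    both sums, while \<open>D v\<close> dominates it and has total v b - v a.\<close>
  define D :: "(real \<Rightarrow> real) \<Rightarrow> nat \<Rightarrow> nat \<Rightarrow> real" where
    "D h i j = h (clip (x i) (x (Suc i)) (y (Suc j))) - h (clip (x i) (x (Suc i)) (y j))" for h i j
  have xi: "a \<le> x i \<and> x i \<le> x (Suc i) \<and> x (Suc i) \<le> b" if "i < n" for i
    using is_partition_bounds[OF px] is_partition_mono[OF px, of i "Suc i"] that
    by (meson Suc_leI less_imp_le lessI)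
  have yj: "a \<le> y j \<and> y j \<le> y (Suc j) \<and> y (Suc j) \<le> b" if "j < m" for j
    using is_partition_bounds[OF py] is_partition_mono[OF py, of j "Suc j"] that
    by (meson Suc_leI less_imp_le lessI)
  have sumj: "(\<Sum>j<m. D h i j) = h (x (Suc i)) - h (x i)" if "i < n" for h i
  proof -
    have "(\<Sum>j<m. D h i j) = h (clip (x i) (x (Suc i)) b) - h (clip (x i) (x (Suc i)) a)"
      unfolding D_def
      using sum_lessThan_telescope[of "\<lambda>j. h (clip (x i) (x (Suc i)) (y j))" m] ye by simp
    also have "\<dots> = h (x (Suc i)) - h (x i)"
      using xi[OF that] by (simp add: clip_def)
    finally show ?thesis .
  qed
  have sumi: "(\<Sum>i<n. D h i j) = h (y (Suc j)) - h (y j)" if "j < m" for h j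
  proof -
    have "(\<Sum>i<n. D h i j)
      = (\<Sum>i<n. h (clip (y j) (y (Suc j)) (x (Suc i))) - h (clip (y j) (y (Suc j)) (x i)))"
      unfolding D_def using xi yj[OF that] by (intro sum.cong refl clip_increment_sym) auto
    also have "\<dots> = h (clip (y j) (y (Suc j)) b) - h (clip (y j) (y (Suc j)) a)"
      using sum_lessThan_telescope[of "\<lambda>i. h (clip (y j) (y (Suc j)) (x i))" n] xe by simp
    also have "\<dots> = h (y (Suc j)) - h (y j)"
      using yj[OF that] by (simp add: clip_def)
    finally show ?thesis .
  qed
  have 1: "RS_sum f g n x \<xi> = (\<Sum>i<n. \<Sum>j<m. D g i j *\<^sub>R f (\<xi> i))"
    unfolding RS_sum_def by (intro sum.cong refl) (simp add: sumj flip: scaleR_left.sum)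
  have 2: "RS_sum f g m y \<zeta> = (\<Sum>i<n. \<Sum>j<m. D g i j *\<^sub>R f (\<zeta> j))"
    unfolding RS_sum_def
    by (subst sum.swap, intro sum.cong refl) (simp add: sumi flip: scaleR_left.sum)
  have summand: "norm (D g i j *\<^sub>R f (\<xi> i) - D g i j *\<^sub>R f (\<zeta> j)) \<le> D v i j * e"
    if ij: "i < n" "j < m" for i j
  proof -
    have Dle: "\<bar>D g i j\<bar> \<le> D v i j"
      unfolding D_def using xi[OF ij(1)] yj[OF ij(2)]
      by (intro increments_leD[OF g]) (auto simp: clip_def)
    show ?thesis
    proof (cases "clip (x i) (x (Suc i)) (y (Suc j)) = clip (x i) (x (Suc i)) (y j)")
      case True
      then show ?thesis by (simp add: D_def)
    next
      case False
      then have ov: "y j < x (Suc i)" "x i < y (Suc j)"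
        using xi[OF ij(1)] yj[OF ij(2)] by (auto simp: clip_def max_def min_def split: if_splits)
      have "x i \<le> \<xi> i" "\<xi> i \<le> x (Suc i)" "x (Suc i) - x i < \<delta>"
        "y j \<le> \<zeta> j" "\<zeta> j \<le> y (Suc j)" "y (Suc j) - y j < \<delta>"
        using P Q ij by (auto simp: fine_tagged_def)
      then have "norm (f (\<xi> i) - f (\<zeta> j)) \<le> e"
        using ov xi[OF ij(1)] yj[OF ij(2)] by (intro osc) (auto simp: abs_less_iff)
      then have "\<bar>D g i j\<bar> * norm (f (\<xi> i) - f (\<zeta> j)) \<le> D v i j * e"
        using Dle by (intro mult_mono) auto
      then show ?thesis by (simp flip: scaleR_diff_right)
    qed
  qed
  have "norm (RS_sum f g n x \<xi> - RS_sum f g m y \<zeta>)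
      = norm (\<Sum>i<n. \<Sum>j<m. D g i j *\<^sub>R f (\<xi> i) - D g i j *\<^sub>R f (\<zeta> j))"
    by (simp add: 1 2 sum_subtractf)
  also have "\<dots> \<le> (\<Sum>i<n. \<Sum>j<m. D v i j * e)"
    by (intro sum_norm_le summand) auto
  also have "\<dots> = (\<Sum>i<n. (v (x (Suc i)) - v (x i)) * e)"
    by (intro sum.cong refl) (simp add: sumj flip: sum_distrib_right)
  also have "\<dots> = (v b - v a) * e"
    using sum_lessThan_telescope[of "\<lambda>i. v (x i)" n] xe by (simp flip: sum_distrib_right)
  finally show ?thesis by (simp add: mult.commute)
qed

text \<open>In \<open>RS_sum_diff_le\<close> the second sum is taken arbitrarily close to
  \<open>I\<close>. The resulting bound involves \<open>g\<close> only through v b - v a, so one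
  partition serves all integrators with a common variation bound.\<close>

lemma RS_sum_dist_integral_le:
  fixes f :: "real \<Rightarrow> 'a::real_normed_vector"
  assumes "a < b" "has_RS_integral f g a b I" and P: "fine_tagged a b \<delta> n x \<xi>"
    and g: "increments_le g v a b" and "\<delta> > 0"
    and osc: "\<And>s t. s \<in> {a..b} \<Longrightarrow> t \<in> {a..b} \<Longrightarrow> \<bar>s - t\<bar> < 2 * \<delta> \<Longrightarrow> norm (f s - f t) \<le> e"
  shows "norm (RS_sum f g n x \<xi> - I) \<le> e * (v b - v a)"
proof (rule field_le_epsilon)
  fix e' :: real assume "e' > 0"
  then obtain \<delta>' where \<delta>': "\<delta>' > 0" 
    and fin: "\<And>n x \<xi>. fine_tagged a b \<delta>' n x \<xi> \<Longrightarrow> norm (RS_sum f g n x \<xi> - I) < e'"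
    using has_RS_integralD[OF assms(2)] by blast
  obtain m y where y: "fine_tagged a b \<delta> m y y" "fine_tagged a b \<delta>' m y y"
    using fine_tagged_exists2[OF assms(1) \<open>\<delta> > 0\<close> \<delta>'] by blast
  have "norm (RS_sum f g n x \<xi> - RS_sum f g m y y) \<le> e * (v b - v a)"
    by (rule RS_sum_diff_le[OF P y(1) g osc])
  moreover have "norm (RS_sum f g m y y - I) < e'" by (rule fin[OF y(2)])
  ultimately show "norm (RS_sum f g n x \<xi> - I) \<le> e * (v b - v a) + e'"
    using norm_triangle_ineq[of "RS_sum f g n x \<xi> - RS_sum f g m y y" "RS_sum f g m y y - I"] 
    by simp
qed

lemma has_RS_integral_unique:
  fixes f :: "real \<Rightarrow> 'a::real_normed_vector"
  assumes "a < b" "has_RS_integral f g a b I" "has_RS_integral f g a b J"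
  shows "I = J"
proof -
  have "norm (I - J) \<le> 0 + e" if "e > 0" for e
  proof -
    have e2: "e / 2 > 0" using that by simp
    obtain d1 where d1: "d1 > 0" "\<And>n x \<xi>. fine_tagged a b d1 n x \<xi> \<Longrightarrow> norm (RS_sum f g n x \<xi> - I) < e / 2"
      using has_RS_integralD[OF assms(2) e2] by blast
    obtain d2 where d2: "d2 > 0" "\<And>n x \<xi>. fine_tagged a b d2 n x \<xi> \<Longrightarrow> norm (RS_sum f g n x \<xi> - J) < e / 2"
      using has_RS_integralD[OF assms(3) e2] by blast
    obtain m y where y: "fine_tagged a b d1 m y y" "fine_tagged a b d2 m y y"
      using fine_tagged_exists2[OF assms(1) d1(1) d2(1)] by blast
    have "norm (I - J) \<le> norm (RS_sum f g m y y - I) + norm (RS_sum f g m y y - J)"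
      using norm_triangle_ineq4[of "RS_sum f g m y y - J" "RS_sum f g m y y - I"] by simp
    then show ?thesis using d1(2)[OF y(1)] d2(2)[OF y(2)] by simp
  qed
  then have "norm (I - J) \<le> 0" by (rule field_le_epsilon)
  then show ?thesis by simp
qed

lemma RS_integral_eqI:
  fixes f :: "real \<Rightarrow> 'a::real_normed_vector"
  assumes "a < b" "has_RS_integral f g a b I"
  shows "RS_integral f g a b = I"
  unfolding RS_integral_def using assms has_RS_integral_unique by blast

lemma has_RS_integral_add:
  fixes f :: "real \<Rightarrow> 'a::real_normed_vector"
  assumes "has_RS_integral f g a b I" "has_RS_integral f h a b J"
  shows "has_RS_integral f (\<lambda>x. g x + h x) a b (I + J)"
  unfolding has_RS_integral_iff
proof (intro allI impI)
  fix e :: real assume "e > 0"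
  then have e2: "e / 2 > 0" by simp
  obtain d1 where d1: "d1 > 0" "\<And>n x \<xi>. fine_tagged a b d1 n x \<xi> \<Longrightarrow> norm (RS_sum f g n x \<xi> - I) < e / 2"
    using has_RS_integralD[OF assms(1) e2] by blast
  obtain d2 where d2: "d2 > 0" "\<And>n x \<xi>. fine_tagged a b d2 n x \<xi> \<Longrightarrow> norm (RS_sum f h n x \<xi> - J) < e / 2"
    using has_RS_integralD[OF assms(2) e2] by blast
  have "norm (RS_sum f (\<lambda>x. g x + h x) n x \<xi> - (I + J)) < e"
    if "fine_tagged a b (min d1 d2) n x \<xi>" for n x \<xi>
  proof -
    have eq: "RS_sum f (\<lambda>x. g x + h x) n x \<xi> - (I + J) = (RS_sum f g n x \<xi> - I) + (RS_sum f h n x \<xi> - J)"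
      by (simp add: RS_sum_def sum.distrib[symmetric] algebra_simps)
    have "norm (RS_sum f g n x \<xi> - I) < e / 2" "norm (RS_sum f h n x \<xi> - J) < e / 2"
      by (intro d1(2) d2(2) fine_tagged_mono[OF that]; simp)+
    then show ?thesis unfolding eq
      using norm_triangle_ineq[of "RS_sum f g n x \<xi> - I" "RS_sum f h n x \<xi> - J"] by linarith
  qed
  then show "\<exists>\<delta>>0. \<forall>n x \<xi>. fine_tagged a b \<delta> n x \<xi> \<longrightarrow>
      norm (RS_sum f (\<lambda>x. g x + h x) n x \<xi> - (I + J)) < e"
    using d1(1) d2(1) by (intro exI[of _ "min d1 d2"]) auto
qed

lemma continuous_on_interval_oscillation:
  fixes f :: "real \<Rightarrow> 'a::real_normed_vector"
  assumes "continuous_on {a..b} f" "e > 0"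
  obtains \<delta> where "\<delta> > 0"
    "\<And>s t. s \<in> {a..b} \<Longrightarrow> t \<in> {a..b} \<Longrightarrow> \<bar>s - t\<bar> < 2 * \<delta> \<Longrightarrow> norm (f s - f t) \<le> e"
proof -
  have "uniformly_continuous_on {a..b} f"
    using assms(1) by (intro compact_uniformly_continuous) auto
  then obtain d where d: "d > 0" 
    "\<And>s t. s \<in> {a..b} \<Longrightarrow> t \<in> {a..b} \<Longrightarrow> dist t s < d \<Longrightarrow> dist (f t) (f s) < e"
    using assms(2) unfolding uniformly_continuous_on_def by blast
  show thesis
    by (rule that[of "d / 2"]) (use d in \<open>auto simp: dist_norm norm_minus_commute less_imp_le\<close>)
qed

text \<open>\<open>RS_sum_diff_le\<close> is the Cauchy condition over tagged partitions; by
  completeness the limit along one sequence of partitions exists, and it is then the value for all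
  fine partitions.\<close>

lemma has_RS_integral_exists:
  fixes f :: "real \<Rightarrow> 'a::banach"
  assumes "a < b" and f: "continuous_on {a..b} f" and g: "increments_le g v a b"
  obtains I where "has_RS_integral f g a b I"
proof -
  \<comment> \<open>The added 1 keeps the divisor positive when \<open>v\<close> is constant and
    makes the final inequality strict.\<close>
  define V where "V = v b - v a + 1"
  have V: "V > 0" using increments_le_mono[OF g, of a b] assms(1) by (simp add: V_def)
  have "\<exists>\<delta>>0. \<forall>s t. s \<in> {a..b} \<longrightarrow> t \<in> {a..b} \<longrightarrow> \<bar>s - t\<bar> < 2 * \<delta> \<longrightarrow> norm (f s - f t) \<le> e / V" if "e > 0" for e
    by (rule continuous_on_interval_oscillation[OF f, of "e / V"]) (use that V in auto)
  then obtain d where d: "\<And>e. e > 0 \<Longrightarrow> d e > 0"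
    "\<And>e s t. e > 0 \<Longrightarrow> s \<in> {a..b} \<Longrightarrow> t \<in> {a..b} \<Longrightarrow> \<bar>s - t\<bar> < 2 * d e \<Longrightarrow> norm (f s - f t) \<le> e / V"
    by metis
  have V1: "e / V * (v b - v a) < e" if "e > 0" for e
    using that V by (simp add: V_def field_simps)
  have diff: "norm (RS_sum f g n x \<xi> - RS_sum f g m y \<zeta>) < e"
    if "e > 0" "fine_tagged a b (d e) n x \<xi>" "fine_tagged a b (d e) m y \<zeta>" for n x \<xi> m y \<zeta> e
    using RS_sum_diff_le[OF that(2,3) g d(2)[OF that(1)]] V1[OF that(1)] by fastforce
  \<comment> \<open>\<open>d\<close> is not known to be monotone in the tolerance; the minimum makes
    the k-th partition fine enough for every tolerance 1/(i+1) with i \<le> k.\<close>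
  define dd where "dd k = Min ((\<lambda>i. d (1 / real (Suc i))) ` {..k})" for k
  have dd: "dd k > 0" for k unfolding dd_def by (subst Min_gr_iff) (auto intro: d)
  have dd_le: "dd k \<le> d (1 / real (Suc i))" if "i \<le> k" for i k
    unfolding dd_def using that by (intro Min_le) auto
  have "\<forall>k. \<exists>n x. fine_tagged a b (dd k) n x x"
    using fine_tagged_exists[OF assms(1) dd] by metis
  then obtain N X where NX: "\<And>k. fine_tagged a b (dd k) (N k) (X k) (X k)" by metis
  have NX': "fine_tagged a b (d (1 / real (Suc i))) (N k) (X k) (X k)" if "i \<le> k" for i k
    using NX dd_le[OF that] fine_tagged_mono by blast
  define S where "S k = RS_sum f g (N k) (X k) (X k)" for k
  have "Cauchy S"
  proof (rule CauchyI)
    fix e :: real assume "e > 0"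
    then obtain i where i: "1 / real (Suc i) < e" using nat_approx_posE by blast
    have "norm (S m - S n) < e" if "m \<ge> i" "n \<ge> i" for m n
      unfolding S_def using diff[of "1 / real (Suc i)", OF _ NX' NX'] that i by fastforce
    then show "\<exists>M. \<forall>m\<ge>M. \<forall>n\<ge>M. norm (S m - S n) < e" by blast
  qed
  then obtain I where I: "S \<longlonglongrightarrow> I" using Cauchy_convergent_iff convergent_def by blast
  have "has_RS_integral f g a b I"
    unfolding has_RS_integral_iff
  proof (intro allI impI)
    fix e :: real assume "e > 0"
    then obtain i where i: "1 / real (Suc i) < e" using nat_approx_posE by blast
    have "norm (RS_sum f g n x \<xi> - I) < e" if "fine_tagged a b (d (1 / real (Suc i))) n x \<xi>" for n x \<xi>
    proof -
      have "(\<lambda>k. norm (RS_sum f g n x \<xi> - S k)) \<longlonglongrightarrow> norm (RS_sum f g n x \<xi> - I)"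
        by (intro tendsto_intros I)
      moreover have "\<forall>\<^sub>F k in sequentially. norm (RS_sum f g n x \<xi> - S k) \<le> 1 / real (Suc i)"
        unfolding S_def eventually_sequentially
        by (intro exI[of _ i] allI impI order.strict_implies_order[OF diff] that NX') auto
      ultimately have "norm (RS_sum f g n x \<xi> - I) \<le> 1 / real (Suc i)"
        by (rule tendsto_upperbound) simp
      then show ?thesis using i by simp
    qed
    then show "\<exists>\<delta>>0. \<forall>n x \<xi>. fine_tagged a b \<delta> n x \<xi> \<longrightarrow> norm (RS_sum f g n x \<xi> - I) < e"
      using d(1)[of "1 / real (Suc i)"] by (intro exI[of _ "d (1 / real (Suc i))"]) auto
  qed
  then show thesis by (rule that)
qed

lemma RS_sum_integrand_diff_le:
  fixes f f' :: "real \<Rightarrow> 'a::real_normed_vector"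
  assumes P: "fine_tagged a b \<delta> n x \<xi>" and g: "increments_le g v a b"
    and le: "\<And>s. s \<in> {a..b} \<Longrightarrow> norm (f s - f' s) \<le> c"
  shows "norm (RS_sum f g n x \<xi> - RS_sum f' g n x \<xi>) \<le> c * (v b - v a)"
proof -
  have px: "is_partition a b n x" using P by (simp add: fine_tagged_def)
  have "RS_sum f g n x \<xi> - RS_sum f' g n x \<xi> = (\<Sum>i<n. (g (x (Suc i)) - g (x i)) *\<^sub>R (f (\<xi> i) - f' (\<xi> i)))"
    by (simp add: RS_sum_def scaleR_diff_right sum_subtractf)
  also have "norm \<dots> \<le> (\<Sum>i<n. (v (x (Suc i)) - v (x i)) * c)"
  proof (rule sum_norm_le)
    fix i assume "i \<in> {..<n}"
    then have i: "i < n" by simp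
    have xi: "a \<le> x i" "x i \<le> \<xi> i" "\<xi> i \<le> x (Suc i)" "x (Suc i) \<le> b"
      using is_partition_bounds[OF px, of i] is_partition_bounds[OF px, of "Suc i"] P i
      by (auto simp: fine_tagged_def)
    show "norm ((g (x (Suc i)) - g (x i)) *\<^sub>R (f (\<xi> i) - f' (\<xi> i))) \<le> (v (x (Suc i)) - v (x i)) * c"
      unfolding norm_scaleR using xi
      by (intro mult_mono increments_leD[OF g] le order_trans[OF _ increments_leD[OF g]]) auto
  qed
  also have "\<dots> = (v b - v a) * c"
    using sum_lessThan_telescope[of "\<lambda>i. v (x i)" n] px
    by (simp add: is_partition_def flip: sum_distrib_right)
  finally show ?thesis by (simp add: mult.commute)
qed

lemma has_RS_integral_integrand_diff_le:
  fixes f f' :: "real \<Rightarrow> 'a::real_normed_vector"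
  assumes "a < b" "has_RS_integral f g a b I" "has_RS_integral f' g a b J" 
    and g: "increments_le g v a b"
    and le: "\<And>s. s \<in> {a..b} \<Longrightarrow> norm (f s - f' s) \<le> c"
  shows "norm (I - J) \<le> c * (v b - v a)"
proof (rule field_le_epsilon)
  fix e :: real assume "e > 0"
  then have e2: "e / 2 > 0" by simp
  obtain d1 where d1: "d1 > 0" "\<And>n x \<xi>. fine_tagged a b d1 n x \<xi> \<Longrightarrow> norm (RS_sum f g n x \<xi> - I) < e / 2"
    using has_RS_integralD[OF assms(2) e2] by blast
  obtain d2 where d2: "d2 > 0" "\<And>n x \<xi>. fine_tagged a b d2 n x \<xi> \<Longrightarrow> norm (RS_sum f' g n x \<xi> - J) < e / 2"
    using has_RS_integralD[OF assms(3) e2] by blast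
  obtain m y where y: "fine_tagged a b d1 m y y" "fine_tagged a b d2 m y y"
    using fine_tagged_exists2[OF assms(1) d1(1) d2(1)] by blast
  have eq: "I - J = (RS_sum f g m y y - RS_sum f' g m y y) - (RS_sum f g m y y - I) + (RS_sum f' g m y y - J)"
    by simp
  have "norm (I - J) \<le> norm (RS_sum f g m y y - RS_sum f' g m y y) + norm (RS_sum f g m y y - I)
     + norm (RS_sum f' g m y y - J)"
    by (subst eq) (rule norm_triangle_le[OF add_right_mono[OF norm_triangle_ineq4]])
  then show "norm (I - J) \<le> c * (v b - v a) + e"
    using RS_sum_integrand_diff_le[OF y(1) g le] d1(2)[OF y(1)] d2(2)[OF y(2)] by fastforce
qed

text \<open>\<open>J\<close> is a candidate for the indefinite integral. Its local error is at most
  variation times oscillation of \<open>f\<close>; telescoping then bounds the error of a whole sum,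
  and the oscillation is small on a fine partition.\<close>

lemma has_RS_integral_primitive:
  fixes f J :: "real \<Rightarrow> 'a::real_normed_vector"
  assumes "a < b" and f: "continuous_on {a..b} f" and g: "increments_le g v a b"
    and J: "\<And>x \<xi> y e. a \<le> x \<Longrightarrow> x \<le> \<xi> \<Longrightarrow> \<xi> \<le> y \<Longrightarrow> y \<le> b \<Longrightarrow>
      (\<And>s. s \<in> {x..y} \<Longrightarrow> norm (f \<xi> - f s) \<le> e) \<Longrightarrow>
      norm ((g y - g x) *\<^sub>R f \<xi> - (J y - J x)) \<le> (v y - v x) * e"
  shows "has_RS_integral f g a b (J b - J a)"
  unfolding has_RS_integral_iff
proof (intro allI impI)
  fix e :: real assume "e > 0"
  define V where "V = v b - v a + 1"
  have V: "V > 0" using increments_le_mono[OF g, of a b] assms(1) by (simp add: V_def)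
  obtain \<delta> where \<delta>: "\<delta> > 0"
    "\<And>s t. s \<in> {a..b} \<Longrightarrow> t \<in> {a..b} \<Longrightarrow> \<bar>s - t\<bar> < 2 * \<delta> \<Longrightarrow> norm (f s - f t) \<le> e / V"
    using continuous_on_interval_oscillation[OF f, of "e / V"] V \<open>e > 0\<close> by auto
  have "norm (RS_sum f g n x \<xi> - (J b - J a)) < e" if P: "fine_tagged a b \<delta> n x \<xi>" for n x \<xi>
  proof -
    have px: "is_partition a b n x" using P by (simp add: fine_tagged_def)
    have "RS_sum f g n x \<xi> - (J b - J a)
      = (\<Sum>i<n. (g (x (Suc i)) - g (x i)) *\<^sub>R f (\<xi> i) - (J (x (Suc i)) - J (x i)))"
      using sum_lessThan_telescope[of "\<lambda>i. J (x i)" n] px 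
      by (simp add: RS_sum_def sum_subtractf is_partition_def)
    also have "norm \<dots> \<le> (\<Sum>i<n. (v (x (Suc i)) - v (x i)) * (e / V))"
    proof (rule sum_norm_le)
      fix i assume "i \<in> {..<n}"
      then have i: "i < n" by simp
      have xi: "a \<le> x i" "x i \<le> \<xi> i" "\<xi> i \<le> x (Suc i)" "x (Suc i) \<le> b" "x (Suc i) - x i < \<delta>"
        using is_partition_bounds[OF px, of i] is_partition_bounds[OF px, of "Suc i"] P i
        by (auto simp: fine_tagged_def)
      show "norm ((g (x (Suc i)) - g (x i)) *\<^sub>R f (\<xi> i) - (J (x (Suc i)) - J (x i)))
        \<le> (v (x (Suc i)) - v (x i)) * (e / V)"
        using xi \<delta>(1) by (intro J \<delta>(2)) auto
    qed
    also have "\<dots> = (v b - v a) * (e / V)"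
      using sum_lessThan_telescope[of "\<lambda>i. v (x i)" n] px
      unfolding sum_distrib_right[symmetric] by (simp add: is_partition_def)
    also have "\<dots> < e" using V \<open>e > 0\<close> by (simp add: V_def field_simps)
    finally show ?thesis .
  qed
  then show "\<exists>\<delta>>0. \<forall>n x \<xi>. fine_tagged a b \<delta> n x \<xi> \<longrightarrow> norm (RS_sum f g n x \<xi> - (J b - J a)) < e"
    using \<delta>(1) by blast
qed

section \<open>The jump part of a function of bounded variation\<close>

lemma is_partition_append:
  assumes "is_partition a x n X" "x \<le> y"
  shows "is_partition a y (Suc n) (X(Suc n := y))"
  using assms by (auto simp: is_partition_def less_Suc_eq)

lemma total_variation_ge:
  "is_partition a b n x \<Longrightarrow> ereal (\<Sum>i<n. \<bar>f (x (Suc i)) - f (x i)\<bar>) \<le> total_variation f a b"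
  unfolding total_variation_def by (rule SUP_upper2[of "(n, x)"]) auto

lemma total_variation_nonneg: "a \<le> b \<Longrightarrow> 0 \<le> total_variation f a b"
  using total_variation_ge[of a b 1 "\<lambda>i. if i = 0 then a else b" f]
  by (force simp: is_partition_def intro: order_trans[rotated])

text \<open>Append \<open>y\<close> to any partition of [a,x]. The finite increment is first moved
  to the other side, so that the bound can be checked for each partition under the supremum.\<close>

lemma total_variation_increment:
  assumes "x \<le> y"
  shows "total_variation f a x + ereal \<bar>f y - f x\<bar> \<le> total_variation f a y"
proof -
  have "total_variation f a x \<le> total_variation f a y - ereal \<bar>f y - f x\<bar>"
    unfolding total_variation_def[of f a x]
  proof (rule SUP_least, clarify)
    fix n X assume X: "is_partition a x n X"
    let ?Y = "X(Suc n := y)"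
    have "(\<Sum>i<Suc n. \<bar>f (?Y (Suc i)) - f (?Y i)\<bar>) = (\<Sum>i<n. \<bar>f (X (Suc i)) - f (X i)\<bar>) + \<bar>f y - f x\<bar>"
      using X by (simp add: is_partition_def)
    then show "ereal (\<Sum>i<n. \<bar>f (X (Suc i)) - f (X i)\<bar>) \<le> total_variation f a y - ereal \<bar>f y - f x\<bar>"
      using total_variation_ge[OF is_partition_append[OF X assms], of f]
      by (simp add: ereal_le_minus)
  qed
  then show ?thesis by (simp add: ereal_le_minus)
qed

text \<open>The witness is the variation function, sending x to the variation over [a,x]; the bound
  \<open>M\<close> makes it real valued on [a,b].\<close>

lemma total_variation_imp_increments_le:
  assumes "a \<le> b" "total_variation f a b \<le> ereal M"
  obtains v where "increments_le f v a b" "v b - v a \<le> M"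
proof -
  define v where "v x = real_of_ereal (total_variation f a x)" for x
  have le: "total_variation f a x \<le> total_variation f a y" if "x \<le> y" for x y
    using total_variation_increment[OF that, of f a]
    by (meson abs_ge_zero add_increasing2 ereal_less_eq(5) order_refl order_trans)
  have v: "total_variation f a x = ereal (v x)" "v x \<ge> 0" if "a \<le> x" "x \<le> b" for x
  proof -
    have "0 \<le> total_variation f a x" "total_variation f a x \<le> ereal M"
      using total_variation_nonneg[OF that(1)] le[OF that(2)] assms(2) by auto
    then show "total_variation f a x = ereal (v x)" "v x \<ge> 0"
      by (cases "total_variation f a x"; auto simp: v_def)+
  qed
  have "increments_le f v a b"
    unfolding increments_le_def
  proof (intro allI impI)
    fix x y assume "a \<le> x \<and> x \<le> y \<and> y \<le> b"
    then show "\<bar>f y - f x\<bar> \<le> v y - v x"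
      using total_variation_increment[of x y f a] v[of x] v[of y] by auto
  qed
  moreover have "v b - v a \<le> M"
    using v[of a] v[of b] assms by simp
  ultimately show thesis by (rule that)
qed

text \<open>The two shapes of interval fit the two kinds of jump: from x to y the saltus function
  picks up right jumps at points of [x,y) and left jumps at points of (x,y].\<close>

lemma infsum_union_real_intervals:
  fixes c :: "real \<Rightarrow> 'a::banach"
  assumes "c summable_on {a..b}" "a \<le> x" "x \<le> y" "y \<le> b"
  shows "infsum c {a..<y} = infsum c {a..<x} + infsum c {x..<y}"
    and "infsum c {a..y} = infsum c {a..x} + infsum c {x<..y}"
proof -
  have sub: "c summable_on A" if "A \<subseteq> {a..b}" for A
    using assms(1) that by (rule summable_on_subset_banach)
  have 1: "{a..<y} = {a..<x} \<union> {x..<y}" and 2: "{a..y} = {a..x} \<union> {x<..y}"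
    using assms by auto
  show "infsum c {a..<y} = infsum c {a..<x} + infsum c {x..<y}"
    unfolding 1 using assms by (intro infsum_Un_disjoint sub) auto
  show "infsum c {a..y} = infsum c {a..x} + infsum c {x<..y}"
    unfolding 2 using assms by (intro infsum_Un_disjoint sub) auto
qed

lemma has_sum_scaleR_left:
  fixes x :: "'a::real_normed_vector"
  assumes "(c has_sum S) A"
  shows "((\<lambda>s. c s *\<^sub>R x) has_sum S *\<^sub>R x) A"
  using has_sum_bounded_linear[OF bounded_linear_scaleR_left[of x] assms] .

text \<open>This is the local estimate that \<open>has_RS_integral_primitive\<close> asks for, when
  the integral over a short interval is a sum over jumps.\<close>

lemma norm_infsum_scaleR_const_diff_le:
  fixes F :: "'b \<Rightarrow> 'a::banach" and c :: "'b \<Rightarrow> real"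
  assumes c: "c summable_on A" and cF: "(\<lambda>s. c s *\<^sub>R F s) summable_on A"
    and le: "\<And>s. s \<in> A \<Longrightarrow> norm (F0 - F s) \<le> e"
  shows "norm (infsum c A *\<^sub>R F0 - infsum (\<lambda>s. c s *\<^sub>R F s) A) \<le> infsum (\<lambda>s. \<bar>c s\<bar>) A * e"
proof -
  have ac: "(\<lambda>s. \<bar>c s\<bar>) summable_on A"
    using c summable_on_iff_abs_summable_on_real[of c A] by simp
  have "(\<lambda>s. c s *\<^sub>R F0) summable_on A" using c by (rule summable_on_scaleR_left)
  moreover have "((\<lambda>s. - (c s *\<^sub>R F s)) has_sum - infsum (\<lambda>s. c s *\<^sub>R F s) A) A"
    using has_sum_infsum[OF cF] by (simp add: has_sum_uminus)
  ultimately have "((\<lambda>s. c s *\<^sub>R F0 + - (c s *\<^sub>R F s)) has_sum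
      (infsum c A *\<^sub>R F0 + - infsum (\<lambda>s. c s *\<^sub>R F s) A)) A"
    by (intro has_sum_add has_sum_infsum has_sum_scaleR_left c)
  moreover have "((\<lambda>s. \<bar>c s\<bar> * e) has_sum (infsum (\<lambda>s. \<bar>c s\<bar>) A * e)) A"
    using ac by (intro has_sum_cmult_left has_sum_infsum)
  moreover have "norm (c s *\<^sub>R F0 + - (c s *\<^sub>R F s)) \<le> \<bar>c s\<bar> * e" if "s \<in> A" for s
  proof -
    have "c s *\<^sub>R F0 + - (c s *\<^sub>R F s) = c s *\<^sub>R (F0 - F s)" by (simp add: scaleR_diff_right)
    then show ?thesis using le[OF that] by (simp add: mult_left_mono)
  qed
  ultimately have "norm (infsum c A *\<^sub>R F0 + - infsum (\<lambda>s. c s *\<^sub>R F s) A) \<le> infsum (\<lambda>s. \<bar>c s\<bar>) A * e"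
    by (rule norm_infsum_le)
  then show ?thesis by simp
qed

text \<open>A finite set \<open>E\<close> carries the whole sum up to e/2. Once \<open>B x\<close>
  avoids \<open>E\<close>, the sums over both together do not exceed the whole, which leaves at most
  e/2 for \<open>B x\<close>.\<close>

lemma summable_tail_vanishes:
  fixes c :: "real \<Rightarrow> real"
  assumes c: "c summable_on A" and nonneg: "\<And>x. x \<in> A \<Longrightarrow> c x \<ge> 0"
    and sub: "\<forall>\<^sub>F x in F. B x \<subseteq> A"
    and avoid: "\<And>y. y \<in> A \<Longrightarrow> \<forall>\<^sub>F x in F. y \<notin> B x"
  shows "((\<lambda>x. infsum c (B x)) \<longlongrightarrow> 0) F"
proof (rule tendstoI)
  fix e :: real assume "e > 0"
  then obtain E where E: "finite E" "E \<subseteq> A" "dist (sum c E) (infsum c A) \<le> e / 2"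
    using infsum_finite_approximation[OF c, of "e / 2"] by auto
  have "\<forall>\<^sub>F x in F. \<forall>y\<in>E. y \<notin> B x"
    using E avoid by (intro eventually_ball_finite) auto
  with sub show "\<forall>\<^sub>F x in F. dist (infsum c (B x)) 0 < e"
  proof eventually_elim
    case (elim x)
    have cB: "c summable_on B x" and cE: "c summable_on E"
      using c elim E by (auto intro: summable_on_subset_banach)
    have "infsum c (B x) + infsum c E = infsum c (B x \<union> E)"
      using cB cE elim by (intro infsum_Un_disjoint[symmetric]) auto
    also have "\<dots> \<le> infsum c A"
      using elim E nonneg c by (intro infsum_mono2 summable_on_subset_banach[OF c]) auto
    finally have "infsum c (B x) \<le> e / 2" using E(1,3) by (simp only: dist_real_def infsum_finite)
    moreover have "infsum c (B x) \<ge> 0" using elim nonneg by (intro infsum_nonneg) auto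
    ultimately show ?case using \<open>e > 0\<close> by (simp add: dist_real_def)
  qed
qed

section \<open>One-sided limits and summability of the jumps\<close>

locale dominated_increments =
  fixes g v :: "real \<Rightarrow> real" and a b :: real
  assumes ab: "a < b" and dom: "increments_le g v a b"
begin

lemma v_mono: "a \<le> x \<Longrightarrow> x \<le> y \<Longrightarrow> y \<le> b \<Longrightarrow> v x \<le> v y"
  using increments_le_mono[OF dom] .

text \<open>Together with \<open>v_mono\<close> this is the Jordan decomposition g = v - (v - g)
  into nondecreasing functions, the source of the one-sided limits.\<close>

lemma v_minus_g_mono: "a \<le> x \<Longrightarrow> x \<le> y \<Longrightarrow> y \<le> b \<Longrightarrow> v x - g x \<le> v y - g y"
  using increments_leD[OF dom, of x y] by linarith

lemma llim_tendsto:
  assumes "a < x" "x \<le> b"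
  shows "(g \<longlongrightarrow> llim g a x) (at_left x)"
proof -
  \<comment> \<open>Monotonicity is known on [a,b] only, so the limit is obtained within {..<x}
    \<inter> {a..b}; since a < x this is the same filter as \<open>at_left x\<close>.\<close>
  have at: "at x within ({..<x} \<inter> {a..b}) = at_left x"
    by (rule at_within_nhd[of _ "{a<..}"]) (use assms in auto)
  have lim: "\<exists>l. (h \<longlongrightarrow> l) (at_left x)" if "\<And>y z. a \<le> y \<Longrightarrow> y \<le> z \<Longrightarrow> z \<le> b \<Longrightarrow> h y \<le> h z" for h :: "real \<Rightarrow> real"
    using Lim_left_bound[of "{a..b}" x h "h x"] that assms unfolding at by auto
  obtain l m where "(v \<longlongrightarrow> l) (at_left x)" "((\<lambda>y. v y - g y) \<longlongrightarrow> m) (at_left x)"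
    using lim[of v] lim[of "\<lambda>y. v y - g y"] v_mono v_minus_g_mono by metis
  then have "((\<lambda>y. v y - (v y - g y)) \<longlongrightarrow> l - m) (at_left x)" by (intro tendsto_diff)
  then have *: "(g \<longlongrightarrow> l - m) (at_left x)" by simp
  then have "Lim (at_left x) g = l - m" by (intro tendsto_Lim) simp
  then show ?thesis using * assms by (simp add: llim_def)
qed

lemma rlim_tendsto:
  assumes "a \<le> x" "x < b"
  shows "(g \<longlongrightarrow> rlim g b x) (at_right x)"
proof -
  have at: "at x within ({x<..} \<inter> {a..b}) = at_right x"
    by (rule at_within_nhd[of _ "{..<b}"]) (use assms in auto)
  have lim: "\<exists>l. (h \<longlongrightarrow> l) (at_right x)" if "\<And>y z. a \<le> y \<Longrightarrow> y \<le> z \<Longrightarrow> z \<le> b \<Longrightarrow> h y \<le> h z" for h :: "real \<Rightarrow> real"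
    using Lim_right_bound[of "{a..b}" x h "h x"] that assms unfolding at by auto
  obtain l m where "(v \<longlongrightarrow> l) (at_right x)" "((\<lambda>y. v y - g y) \<longlongrightarrow> m) (at_right x)"
    using lim[of v] lim[of "\<lambda>y. v y - g y"] v_mono v_minus_g_mono by metis
  then have "((\<lambda>y. v y - (v y - g y)) \<longlongrightarrow> l - m) (at_right x)" by (intro tendsto_diff)
  then have *: "(g \<longlongrightarrow> l - m) (at_right x)" by simp
  then have "Lim (at_right x) g = l - m" by (intro tendsto_Lim) simp
  then show ?thesis using * assms by (simp add: rlim_def)
qed

text \<open>The jump is split at the value g x because the saltus function has taken only the left
  half at x itself and takes the right half immediately after x.\<close>

definition left_jump :: "real \<Rightarrow> real" where "left_jump x = g x - llim g a x"
definition right_jump :: "real \<Rightarrow> real" where "right_jump x = rlim g b x - g x"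

text \<open>The bound uses \<open>v\<close> only on [z,x] with z arbitrary, so that jumps at
  different points can be charged to non-overlapping intervals.\<close>

lemma left_jump_le:
  assumes "a \<le> z" "z < x" "x \<le> b"
  shows "\<bar>left_jump x\<bar> \<le> v x - v z"
proof -
  have "((\<lambda>y. \<bar>g x - g y\<bar>) \<longlongrightarrow> \<bar>left_jump x\<bar>) (at_left x)"
    unfolding left_jump_def using assms by (intro tendsto_intros llim_tendsto) auto
  moreover have "\<forall>\<^sub>F y in at_left x. \<bar>g x - g y\<bar> \<le> v x - v z"
    unfolding eventually_at_left_field
  proof (intro exI[of _ z] conjI allI impI)
    fix y assume y: "y > z" "y < x"
    then show "\<bar>g x - g y\<bar> \<le> v x - v z"
      using assms increments_leD[OF dom, of y x] v_mono[of z y] by linarith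
  qed (use assms in simp)
  ultimately show ?thesis by (rule tendsto_upperbound) simp
qed

lemma right_jump_le:
  assumes "a \<le> x" "x < z" "z \<le> b"
  shows "\<bar>right_jump x\<bar> \<le> v z - v x"
proof -
  have "((\<lambda>y. \<bar>g y - g x\<bar>) \<longlongrightarrow> \<bar>right_jump x\<bar>) (at_right x)"
    unfolding right_jump_def using assms by (intro tendsto_intros rlim_tendsto) auto
  moreover have "\<forall>\<^sub>F y in at_right x. \<bar>g y - g x\<bar> \<le> v z - v x"
    unfolding eventually_at_right_field
  proof (intro exI[of _ z] conjI allI impI)
    fix y assume y: "y > x" "y < z"
    then show "\<bar>g y - g x\<bar> \<le> v z - v x"
      using assms increments_leD[OF dom, of x y] v_mono[of y z] by linarith
  qed (use assms in simp)
  ultimately show ?thesis by (rule tendsto_upperbound) simp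
qed

lemma left_jump_a: "left_jump a = 0" and right_jump_b: "right_jump b = 0"
  by (simp_all add: left_jump_def right_jump_def llim_def rlim_def)

text \<open>The jumps are charged to non-overlapping pieces of [a,c]: for the largest point m, its
  right jump to [m,c], its left jump to [z,m], and all earlier points to [a,z]. The strict y < c
  leaves room for the last right jump.\<close>

lemma sum_jumps_le_left:
  assumes "finite E" "E \<subseteq> {a..b}" "c \<le> b" "a \<le> c" "\<And>y. y \<in> E \<Longrightarrow> y < c"
  shows "(\<Sum>y\<in>E. \<bar>left_jump y\<bar> + \<bar>right_jump y\<bar>) \<le> v c - v a"
  using assms
proof (induction E arbitrary: c rule: finite_linorder_max_induct)
  case empty
  then show ?case using v_mono[of a c] by simp
next
  case (insert m E)
  then have m: "a \<le> m" "m < c" "m \<le> b" by auto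
  have "(\<Sum>y\<in>E. \<bar>left_jump y\<bar> + \<bar>right_jump y\<bar>) + \<bar>left_jump m\<bar> \<le> v m - v a"
  proof (cases "m = a")
    \<comment> \<open>There is no room to the left of \<open>a\<close>, but the left jump there is 0
      by the convention for \<open>llim\<close>.\<close>
    case True
    then have "E = {}" using insert by fastforce
    then show ?thesis using True by (simp add: left_jump_a)
  next
    case False
    \<comment> \<open>Midpoints place z strictly between every earlier point and m; inserting
      \<open>a\<close> covers an empty \<open>E\<close> and keeps z in the interval.\<close>
    define z where "z = Max (insert a ((\<lambda>y. (y + m) / 2) ` E))"
    have z: "a \<le> z" "z < m" using insert m False by (auto simp: z_def intro!: Max_ge)
    have "y < z" if "y \<in> E" for y
    proof -
      have "(y + m) / 2 \<le> z" unfolding z_def using insert that by (intro Max_ge) auto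
      moreover have "y < m" using insert that by blast
      ultimately show ?thesis by argo
    qed
    then have "(\<Sum>y\<in>E. \<bar>left_jump y\<bar> + \<bar>right_jump y\<bar>) \<le> v z - v a"
      using insert.prems z m by (intro insert.IH) (auto simp: less_imp_le)
    then show ?thesis using left_jump_le[of z m] z m insert.prems by auto
  qed
  moreover have "\<bar>right_jump m\<bar> \<le> v c - v m" using m insert.prems by (intro right_jump_le) auto
  moreover have "m \<notin> E" using insert by blast
  ultimately show ?case using insert.hyps by simp
qed

text \<open>\<open>sum_jumps_le_left\<close> needs room to the right of the points. The point b has
  none, but its right jump is 0, so only its left jump has to be charged, to an interval [z,b]
  beyond the other points.\<close>

lemma sum_jumps_le:
  assumes "finite E" "E \<subseteq> {a..b}"
  shows "(\<Sum>y\<in>E. \<bar>left_jump y\<bar> + \<bar>right_jump y\<bar>) \<le> v b - v a"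
proof -
  have fin: "finite (E - {b})" "E - {b} \<subseteq> {a..b}" using assms by auto
  have "(\<Sum>y\<in>E. \<bar>left_jump y\<bar> + \<bar>right_jump y\<bar>)
      \<le> (\<Sum>y\<in>E - {b}. \<bar>left_jump y\<bar> + \<bar>right_jump y\<bar>) + \<bar>left_jump b\<bar>"
    using assms(1) by (cases "b \<in> E") (auto simp: sum.remove[of E b] right_jump_b)
  also have "\<dots> \<le> v b - v a"
  proof -
    define z where "z = Max (insert a ((\<lambda>y. (y + b) / 2) ` (E - {b})))"
    have lt: "y < b" if "y \<in> E - {b}" for y using that assms by fastforce
    have z: "a \<le> z" "z < b" using fin ab lt by (auto simp: z_def intro!: Max_ge)
    have "y < z" if "y \<in> E - {b}" for y
    proof -
      have "(y + b) / 2 \<le> z" unfolding z_def using fin that by (intro Max_ge) auto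
      then show ?thesis using lt[OF that] by argo
    qed
    then have "(\<Sum>y\<in>E - {b}. \<bar>left_jump y\<bar> + \<bar>right_jump y\<bar>) \<le> v z - v a"
      using fin z by (intro sum_jumps_le_left) auto
    then show ?thesis using left_jump_le[of z b] z by auto
  qed
  finally show ?thesis .
qed

lemma abs_jumps_summable: "(\<lambda>y. \<bar>left_jump y\<bar> + \<bar>right_jump y\<bar>) summable_on {a..b}"
  by (rule nonneg_bdd_above_summable_on) (auto intro!: bdd_aboveI2 sum_jumps_le)

lemma infsum_abs_jumps_le: "infsum (\<lambda>y. \<bar>left_jump y\<bar> + \<bar>right_jump y\<bar>) {a..b} \<le> v b - v a"
  by (rule infsum_le_finite_sums[OF abs_jumps_summable]) (rule sum_jumps_le)

lemma abs_left_jump_summable: "(\<lambda>y. \<bar>left_jump y\<bar>) summable_on {a..b}"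
  and abs_right_jump_summable: "(\<lambda>y. \<bar>right_jump y\<bar>) summable_on {a..b}"
proof -
  have *: "(\<lambda>y. norm (\<bar>left_jump y\<bar> + \<bar>right_jump y\<bar>)) summable_on {a..b}"
    using abs_jumps_summable by simp
  show "(\<lambda>y. \<bar>left_jump y\<bar>) summable_on {a..b}" "(\<lambda>y. \<bar>right_jump y\<bar>) summable_on {a..b}"
    using Infinite_Sum.abs_summable_on_comparison_test[OF *, of left_jump]
      Infinite_Sum.abs_summable_on_comparison_test[OF *, of right_jump] by auto
qed

lemma left_jump_summable: "left_jump summable_on {a..b}"
  and right_jump_summable: "right_jump summable_on {a..b}"
  using abs_left_jump_summable abs_right_jump_summable
    summable_on_iff_abs_summable_on_real[of left_jump "{a..b}"]
    summable_on_iff_abs_summable_on_real[of right_jump "{a..b}"] by auto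

lemma jump_scaleR_summable:
  fixes f :: "real \<Rightarrow> 'a::banach"
  assumes "continuous_on {a..b} f"
  shows "(\<lambda>y. left_jump y *\<^sub>R f y) summable_on {a..b}" "(\<lambda>y. right_jump y *\<^sub>R f y) summable_on {a..b}"
proof -
  have "bounded (f ` {a..b})" using assms by (intro compact_imp_bounded compact_continuous_image) auto
  then obtain K where K: "\<And>y. y \<in> {a..b} \<Longrightarrow> norm (f y) \<le> K" unfolding bounded_iff by blast
  have *: "(\<lambda>y. c y *\<^sub>R f y) summable_on {a..b}" if "(\<lambda>y. \<bar>c y\<bar>) summable_on {a..b}" for c
  proof (rule abs_summable_summable, rule Infinite_Sum.abs_summable_on_comparison_test)
    show "(\<lambda>y. norm (\<bar>c y\<bar> * K)) summable_on {a..b}"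
      using summable_on_cmult_left[OF that, of K]
        summable_on_iff_abs_summable_on_real[of "\<lambda>y. \<bar>c y\<bar> * K" "{a..b}"] by simp
    show "norm (c y *\<^sub>R f y) \<le> norm (\<bar>c y\<bar> * K)" if "y \<in> {a..b}" for y
      using mult_left_mono[OF order_trans[OF K[OF that] abs_ge_self], of "\<bar>c y\<bar>"]
      by (simp add: abs_mult)
  qed
  show "(\<lambda>y. left_jump y *\<^sub>R f y) summable_on {a..b}" "(\<lambda>y. right_jump y *\<^sub>R f y) summable_on {a..b}"
    by (intro * abs_left_jump_summable abs_right_jump_summable)+
qed

section \<open>The jump part as an integrator\<close>

abbreviation "s \<equiv> jump_part g a b"

text \<open>Inner jumps are split into halves and regrouped; the separate terms at \<open>a\<close>
  and \<open>x\<close> supply the remaining halves, and \<open>left_jump_a\<close> lets the second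
  sum start at \<open>a\<close>. In this additive form increments are sums over intervals.\<close>

lemma jump_part_eq:
  assumes "x \<in> {a..b}"
  shows "s x = infsum right_jump {a..<x} + infsum left_jump {a..x}"
proof (cases "x = a")
  case True
  then show ?thesis by (simp add: jump_part_def left_jump_a)
next
  case False
  then have x: "a < x" "x \<le> b" using assms by auto
  have sub: "right_jump summable_on A" "left_jump summable_on A" if "A \<subseteq> {a..b}" for A
    using right_jump_summable left_jump_summable that by (auto intro: summable_on_subset_banach)
  have e1: "{a..<x} = insert a {a<..<x}" and e2: "{a..x} = insert a (insert x {a<..<x})"
    using x by auto
  have "infsum right_jump {a..<x} = right_jump a + infsum right_jump {a<..<x}"
    unfolding e1 using x by (intro infsum_insert sub) auto
  moreover have "infsum left_jump {a..x} = left_jump a + (left_jump x + infsum left_jump {a<..<x})"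
  proof -
    have "infsum left_jump (insert x {a<..<x}) = left_jump x + infsum left_jump {a<..<x}"
      using x by (intro infsum_insert sub) auto
    moreover have "infsum left_jump {a..x} = left_jump a + infsum left_jump (insert x {a<..<x})"
      unfolding e2 using x by (intro infsum_insert sub) auto
    ultimately show ?thesis by simp
  qed
  moreover have "infsum (\<lambda>y. rlim g b y - llim g a y) {a<..<x} = infsum right_jump {a<..<x} + infsum left_jump {a<..<x}"
    using x by (subst infsum_add[symmetric]) (auto intro!: sub infsum_cong simp: right_jump_def left_jump_def)
  ultimately show ?thesis
    using x by (simp add: jump_part_def left_jump_a) (simp add: right_jump_def left_jump_def)
qed

text \<open>The formula of \<open>jump_part_eq\<close> with absolute values, used as the dominating
  function of the jump part.\<close>

definition w :: "real \<Rightarrow> real" where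
  "w x = infsum (\<lambda>y. \<bar>right_jump y\<bar>) {a..<x} + infsum (\<lambda>y. \<bar>left_jump y\<bar>) {a..x}"

lemma w_diff:
  assumes "a \<le> x" "x \<le> y" "y \<le> b"
  shows "w y - w x = infsum (\<lambda>y. \<bar>right_jump y\<bar>) {x..<y} + infsum (\<lambda>y. \<bar>left_jump y\<bar>) {x<..y}"
  using infsum_union_real_intervals(1)[OF abs_right_jump_summable assms]
    infsum_union_real_intervals(2)[OF abs_left_jump_summable assms] by (simp add: w_def)

lemma jump_part_diff:
  assumes "a \<le> x" "x \<le> y" "y \<le> b"
  shows "s y - s x = infsum right_jump {x..<y} + infsum left_jump {x<..y}"
  using infsum_union_real_intervals(1)[OF right_jump_summable assms]
    infsum_union_real_intervals(2)[OF left_jump_summable assms] assms by (simp add: jump_part_eq)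

lemma increments_le_jump_part: "increments_le s w a b"
  unfolding increments_le_def
proof (intro allI impI)
  fix x y assume *: "a \<le> x \<and> x \<le> y \<and> y \<le> b"
  have "\<bar>infsum right_jump {x..<y}\<bar> \<le> infsum (\<lambda>y. \<bar>right_jump y\<bar>) {x..<y}"
    using * norm_infsum_bound[of right_jump "{x..<y}"]
    by (force intro: summable_on_subset_banach abs_right_jump_summable)
  moreover have "\<bar>infsum left_jump {x<..y}\<bar> \<le> infsum (\<lambda>y. \<bar>left_jump y\<bar>) {x<..y}"
    using * norm_infsum_bound[of left_jump "{x<..y}"]
    by (force intro: summable_on_subset_banach abs_left_jump_summable)
  ultimately show "\<bar>s y - s x\<bar> \<le> w y - w x"
    using * by (simp add: w_diff jump_part_diff)
qed

text \<open>Both interval sums are parts of the sum of all absolute jumps. Hence removing the jump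
  part from \<open>g\<close> at most doubles the available variation bound.\<close>

lemma w_total_le: "w b - w a \<le> v b - v a"
proof -
  have "infsum (\<lambda>y. \<bar>right_jump y\<bar>) {a..<b} \<le> infsum (\<lambda>y. \<bar>right_jump y\<bar>) {a..b}"
    by (intro infsum_mono2 summable_on_subset_banach[OF abs_right_jump_summable]) auto
  moreover have "infsum (\<lambda>y. \<bar>left_jump y\<bar>) {a<..b} \<le> infsum (\<lambda>y. \<bar>left_jump y\<bar>) {a..b}"
    by (intro infsum_mono2 summable_on_subset_banach[OF abs_left_jump_summable]) auto
  ultimately show ?thesis
    using w_diff[of a b] ab infsum_abs_jumps_le
      infsum_add[OF abs_left_jump_summable abs_right_jump_summable] by simp
qed

text \<open>Beyond the right jump at x, the increment s y - s x consists of jumps located in (x,y].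
  Each fixed point eventually leaves this interval as y decreases to x, so their sum
  vanishes.\<close>

lemma jump_part_right_limit:
  assumes "a \<le> x" "x < b"
  shows "(s \<longlongrightarrow> s x + right_jump x) (at_right x)"
proof -
  have ev: "\<forall>\<^sub>F y in at_right x. x < y \<and> y < b"
    using assms by (simp add: eventually_at_right_field) blast
  have av: "\<forall>\<^sub>F y in at_right x. z \<notin> {x<..y}" for z
  proof (cases "x < z")
    case True
    have "\<forall>\<^sub>F y in at_right x. y < z" using True by (simp add: eventually_at_right_field) blast
    then show ?thesis by eventually_elim auto
  qed auto
  have sub: "\<forall>\<^sub>F y in at_right x. {x<..y} \<subseteq> {a..b}"
    using ev by eventually_elim (use assms in auto)
  have lim: "((\<lambda>y. infsum (\<lambda>y. \<bar>left_jump y\<bar> + \<bar>right_jump y\<bar>) {x<..y}) \<longlongrightarrow> 0) (at_right x)"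
    by (rule summable_tail_vanishes[OF abs_jumps_summable _ sub av]) auto
  have "((\<lambda>y. s y - (s x + right_jump x)) \<longlongrightarrow> 0) (at_right x)"
  proof (rule Lim_null_comparison[OF _ lim], use ev in eventually_elim)
    case (elim y)
    have ss: "c summable_on {a..b} \<Longrightarrow> c summable_on {x<..<y}" "c summable_on {a..b} \<Longrightarrow> c summable_on {x<..y}" for c :: "real \<Rightarrow> real"
      using elim assms by (auto elim!: summable_on_subset_banach)
    have e: "{x..<y} = insert x {x<..<y}" using elim by auto
    have "infsum right_jump {x..<y} = right_jump x + infsum right_jump {x<..<y}"
      unfolding e by (intro infsum_insert ss right_jump_summable) auto
    then have eq: "s y - (s x + right_jump x) = infsum right_jump {x<..<y} + infsum left_jump {x<..y}"
      using jump_part_diff[of x y] elim assms by simp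
    have "\<bar>infsum right_jump {x<..<y}\<bar> \<le> infsum (\<lambda>y. \<bar>right_jump y\<bar>) {x<..<y}"
      using norm_infsum_bound[of right_jump "{x<..<y}"] ss(1)[OF abs_right_jump_summable] by simp
    moreover have "\<dots> \<le> infsum (\<lambda>y. \<bar>right_jump y\<bar>) {x<..y}"
      by (intro infsum_mono2 ss abs_right_jump_summable) auto
    moreover have "\<bar>infsum left_jump {x<..y}\<bar> \<le> infsum (\<lambda>y. \<bar>left_jump y\<bar>) {x<..y}"
      using norm_infsum_bound[of left_jump "{x<..y}"] ss(2)[OF abs_left_jump_summable] by simp
    ultimately show ?case unfolding eq
      using infsum_add[OF ss(2)[OF abs_left_jump_summable] ss(2)[OF abs_right_jump_summable]] by simp
  qed
  then show ?thesis by (simp add: LIM_zero_iff)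
qed

text \<open>Mirror image of \<open>jump_part_right_limit\<close>: the remaining jumps are located in
  [y,x).\<close>

lemma jump_part_left_limit:
  assumes "a < x" "x \<le> b"
  shows "(s \<longlongrightarrow> s x - left_jump x) (at_left x)"
proof -
  have ev: "\<forall>\<^sub>F y in at_left x. a < y \<and> y < x"
    using assms by (simp add: eventually_at_left_field) blast
  have av: "\<forall>\<^sub>F y in at_left x. z \<notin> {y..<x}" for z
  proof (cases "z < x")
    case True
    have "\<forall>\<^sub>F y in at_left x. z < y" using True by (simp add: eventually_at_left_field) blast
    then show ?thesis by eventually_elim auto
  qed auto
  have sub: "\<forall>\<^sub>F y in at_left x. {y..<x} \<subseteq> {a..b}"
    using ev by eventually_elim (use assms in auto)
  have lim: "((\<lambda>y. infsum (\<lambda>y. \<bar>left_jump y\<bar> + \<bar>right_jump y\<bar>) {y..<x}) \<longlongrightarrow> 0) (at_left x)"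
    by (rule summable_tail_vanishes[OF abs_jumps_summable _ sub av]) auto
  have "((\<lambda>y. s y - (s x - left_jump x)) \<longlongrightarrow> 0) (at_left x)"
  proof (rule Lim_null_comparison[OF _ lim], use ev in eventually_elim)
    case (elim y)
    have ss: "c summable_on {a..b} \<Longrightarrow> c summable_on {y<..<x}" "c summable_on {a..b} \<Longrightarrow> c summable_on {y..<x}" for c :: "real \<Rightarrow> real"
      using elim assms by (auto elim!: summable_on_subset_banach)
    have e: "{y<..x} = insert x {y<..<x}" using elim by auto
    have "infsum left_jump {y<..x} = left_jump x + infsum left_jump {y<..<x}"
      unfolding e by (intro infsum_insert ss left_jump_summable) auto
    then have eq: "s y - (s x - left_jump x) = - (infsum right_jump {y..<x} + infsum left_jump {y<..<x})"
      using jump_part_diff[of y x] elim assms by simp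
    have "\<bar>infsum left_jump {y<..<x}\<bar> \<le> infsum (\<lambda>y. \<bar>left_jump y\<bar>) {y<..<x}"
      using norm_infsum_bound[of left_jump "{y<..<x}"] ss(1)[OF abs_left_jump_summable] by simp
    moreover have "\<dots> \<le> infsum (\<lambda>y. \<bar>left_jump y\<bar>) {y..<x}"
      by (intro infsum_mono2 ss abs_left_jump_summable) auto
    moreover have "\<bar>infsum right_jump {y..<x}\<bar> \<le> infsum (\<lambda>y. \<bar>right_jump y\<bar>) {y..<x}"
      using norm_infsum_bound[of right_jump "{y..<x}"] ss(2)[OF abs_right_jump_summable] by simp
    ultimately show ?case unfolding eq
      using infsum_add[OF ss(2)[OF abs_left_jump_summable] ss(2)[OF abs_right_jump_summable]] by simp
  qed
  then show ?thesis by (simp add: LIM_zero_iff)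
qed

text \<open>(A3) prescribes the jumps of the saltus function, whereas the integral is computed from
  the jumps of \<open>g\<close>; this identifies the two. At the ends the missing half is 0 by the
  conventions for one-sided limits.\<close>

lemma jump_jump_part:
  assumes "x \<in> {a..b}"
  shows "jump s a b x = left_jump x + right_jump x"
proof -
  have "rlim s b x = s x + right_jump x"
  proof (cases "x < b")
    case True
    then have "Lim (at_right x) s = s x + right_jump x"
      using assms by (intro tendsto_Lim jump_part_right_limit) auto
    then show ?thesis using True by (simp add: rlim_def)
  next
    case False
    then have "x = b" using assms by auto
    then show ?thesis using right_jump_b by (simp add: rlim_def)
  qed
  moreover have "llim s a x = s x - left_jump x"
  proof (cases "a < x")
    case True
    then have "Lim (at_left x) s = s x - left_jump x"
      using assms by (intro tendsto_Lim jump_part_left_limit) auto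
    then show ?thesis using True by (simp add: llim_def)
  next
    case False
    then have "x = a" using assms by auto
    then show ?thesis using left_jump_a by (simp add: llim_def)
  qed
  ultimately show ?thesis by (simp add: jump_def)
qed

lemma has_RS_integral_jump_part:
  fixes f :: "real \<Rightarrow> 'a::banach"
  assumes f: "continuous_on {a..b} f"
  shows "has_RS_integral f s a b (infsum (\<lambda>y. jump s a b y *\<^sub>R f y) {a..b})"
proof -
  \<comment> \<open>The indefinite integral: the formula of \<open>jump_part_eq\<close> with every
    jump at y weighted by f y.\<close>
  define J where "J x = infsum (\<lambda>y. right_jump y *\<^sub>R f y) {a..<x} + infsum (\<lambda>y. left_jump y *\<^sub>R f y) {a..x}" for x
  note R = jump_scaleR_summable(2)[OF f] and L = jump_scaleR_summable(1)[OF f]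
  have Jdiff: "J y - J x = infsum (\<lambda>y. right_jump y *\<^sub>R f y) {x..<y} + infsum (\<lambda>y. left_jump y *\<^sub>R f y) {x<..y}"
    if "a \<le> x" "x \<le> y" "y \<le> b" for x y
    using infsum_union_real_intervals(1)[OF R that] infsum_union_real_intervals(2)[OF L that]
    by (simp add: J_def)
  have "has_RS_integral f s a b (J b - J a)"
  proof (rule has_RS_integral_primitive[OF ab f increments_le_jump_part])
    fix x \<xi> y e assume xy: "a \<le> x" "x \<le> \<xi>" "\<xi> \<le> y" "y \<le> b"
      and osc: "\<And>s. s \<in> {x..y} \<Longrightarrow> norm (f \<xi> - f s) \<le> e"
    have sub: "{x..<y} \<subseteq> {a..b}" "{x<..y} \<subseteq> {a..b}" using xy by auto
    have 1: "norm (infsum right_jump {x..<y} *\<^sub>R f \<xi> - infsum (\<lambda>y. right_jump y *\<^sub>R f y) {x..<y})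
        \<le> infsum (\<lambda>y. \<bar>right_jump y\<bar>) {x..<y} * e"
      using sub osc by (intro norm_infsum_scaleR_const_diff_le summable_on_subset_banach[OF R]
          summable_on_subset_banach[OF right_jump_summable]) auto
    have 2: "norm (infsum left_jump {x<..y} *\<^sub>R f \<xi> - infsum (\<lambda>y. left_jump y *\<^sub>R f y) {x<..y})
        \<le> infsum (\<lambda>y. \<bar>left_jump y\<bar>) {x<..y} * e"
      using sub osc by (intro norm_infsum_scaleR_const_diff_le summable_on_subset_banach[OF L]
          summable_on_subset_banach[OF left_jump_summable]) auto
    have "(s y - s x) *\<^sub>R f \<xi> - (J y - J x)
      = (infsum right_jump {x..<y} *\<^sub>R f \<xi> - infsum (\<lambda>y. right_jump y *\<^sub>R f y) {x..<y})
      + (infsum left_jump {x<..y} *\<^sub>R f \<xi> - infsum (\<lambda>y. left_jump y *\<^sub>R f y) {x<..y})"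
      using xy by (simp add: Jdiff jump_part_diff algebra_simps)
    moreover have "(w y - w x) * e
      = infsum (\<lambda>y. \<bar>right_jump y\<bar>) {x..<y} * e + infsum (\<lambda>y. \<bar>left_jump y\<bar>) {x<..y} * e"
      using xy by (simp add: w_diff algebra_simps)
    ultimately show "norm ((s y - s x) *\<^sub>R f \<xi> - (J y - J x)) \<le> (w y - w x) * e"
      using norm_triangle_mono[OF 1 2] by simp
  qed
  \<comment> \<open>The half-open intervals omit b and a, which carry no right and no left jump
    respectively.\<close>
  moreover have "J b - J a = infsum (\<lambda>y. jump s a b y *\<^sub>R f y) {a..b}"
  proof -
    have "infsum (\<lambda>y. right_jump y *\<^sub>R f y) {a..<b} = infsum (\<lambda>y. right_jump y *\<^sub>R f y) {a..b}"
    proof (rule infsum_cong_neutral)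
      fix y assume "y \<in> {a..b} - {a..<b}"
      then have "y = b" by auto
      then show "right_jump y *\<^sub>R f y = 0" by (simp add: right_jump_b)
    qed auto
    moreover have "infsum (\<lambda>y. left_jump y *\<^sub>R f y) {a<..b} = infsum (\<lambda>y. left_jump y *\<^sub>R f y) {a..b}"
    proof (rule infsum_cong_neutral)
      fix y assume "y \<in> {a..b} - {a<..b}"
      then have "y = a" by auto
      then show "left_jump y *\<^sub>R f y = 0" by (simp add: left_jump_a)
    qed auto
    moreover have "infsum (\<lambda>y. jump s a b y *\<^sub>R f y) {a..b}
        = infsum (\<lambda>y. left_jump y *\<^sub>R f y + right_jump y *\<^sub>R f y) {a..b}"
      by (intro infsum_cong) (simp add: jump_jump_part scaleR_left_distrib)
    ultimately show ?thesis
      using ab by (simp add: Jdiff infsum_add[OF L R])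
  qed
  ultimately show ?thesis by simp
qed

end

text \<open>Several indices k may share a location. The pairs (y,k) with \<tau> k = y correspond
  bijectively to the indices, and absolute convergence permits summing over each fibre
  first.\<close>

lemma infsum_grouped_by_location:
  fixes f :: "'b \<Rightarrow> 'a::banach" and h :: "nat \<Rightarrow> real" and \<tau> :: "nat \<Rightarrow> 'b"
  assumes h: "summable (\<lambda>k. \<bar>h k\<bar>)" and \<tau>: "\<And>k. \<tau> k \<in> Y" and f: "\<And>y. y \<in> Y \<Longrightarrow> norm (f y) \<le> K"
  shows "infsum (\<lambda>y. (\<Sum>k. if \<tau> k = y then h k else 0) *\<^sub>R f y) Y = (\<Sum>k. h k *\<^sub>R f (\<tau> k))"
proof -
  have "summable (\<lambda>k. norm (h k *\<^sub>R f (\<tau> k)))"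
  proof (rule summable_comparison_test'[of "\<lambda>k. \<bar>h k\<bar> * K" 0])
    show "summable (\<lambda>k. \<bar>h k\<bar> * K)" using h by (rule summable_mult2)
    show "norm (norm (h k *\<^sub>R f (\<tau> k))) \<le> \<bar>h k\<bar> * K" for k
      using f[OF \<tau>[of k]] by (simp add: mult_left_mono)
  qed
  from this summable_sums[OF summable_norm_cancel[OF this]]
  have hs: "((\<lambda>k. h k *\<^sub>R f (\<tau> k)) has_sum (\<Sum>k. h k *\<^sub>R f (\<tau> k))) UNIV"
    by (rule norm_summable_imp_has_sum)
  have bij: "bij_betw snd (Sigma Y (\<lambda>y. {k. \<tau> k = y})) UNIV"
    by (rule bij_betwI[of _ _ _ "\<lambda>k. (\<tau> k, k)"]) (use \<tau> in auto)
  have "((\<lambda>z. h (snd z) *\<^sub>R f (\<tau> (snd z))) has_sum (\<Sum>k. h k *\<^sub>R f (\<tau> k))) (Sigma Y (\<lambda>y. {k. \<tau> k = y}))"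
    using hs has_sum_reindex_bij_betw[OF bij, of "\<lambda>k. h k *\<^sub>R f (\<tau> k)"] by simp
  then have "((\<lambda>y. (\<Sum>k. if \<tau> k = y then h k else 0) *\<^sub>R f y) has_sum (\<Sum>k. h k *\<^sub>R f (\<tau> k))) Y"
  proof (rule has_sum_SigmaD)
    fix y assume "y \<in> Y"
    have sm: "summable (\<lambda>k. norm (if \<tau> k = y then h k else 0))"
      by (rule summable_comparison_test'[OF h, of 0]) auto
    from this summable_sums[OF summable_norm_cancel[OF this]]
    have "((\<lambda>k. if \<tau> k = y then h k else 0) has_sum (\<Sum>k. if \<tau> k = y then h k else 0)) UNIV"
      by (rule norm_summable_imp_has_sum)
    then have "(h has_sum (\<Sum>k. if \<tau> k = y then h k else 0)) {k. \<tau> k = y}"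
      by (rule has_sum_cong_neutral[THEN iffD1, rotated -1]) auto
    then have "((\<lambda>k. h k *\<^sub>R f y) has_sum (\<Sum>k. if \<tau> k = y then h k else 0) *\<^sub>R f y) {k. \<tau> k = y}"
      by (rule has_sum_scaleR_left)
    then show "((\<lambda>k. h (snd (y, k)) *\<^sub>R f (\<tau> (snd (y, k)))) has_sum
        (\<Sum>k. if \<tau> k = y then h k else 0) *\<^sub>R f y) {k. \<tau> k = y}"
      by (rule has_sum_cong[THEN iffD1, rotated]) auto
  qed
  then show ?thesis by (rule infsumI)
qed

section \<open>Stieltjes integrals depending on a parameter\<close>

text \<open>Four errors below e/4: f z is replaced by f z0, the integral by a sum, c z by c z0 at
  the finitely many nodes, and the sum by the integral again. The partition is chosen from f z0
  alone and therefore serves every z.\<close>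

lemma continuous_on_RS_integral_dominated:
  fixes f :: "'z::metric_space \<Rightarrow> real \<Rightarrow> 'a::banach" and c v :: "'z \<Rightarrow> real \<Rightarrow> real"
  assumes ab: "a < b"
    and f: "\<And>z. z \<in> Z \<Longrightarrow> continuous_on {a..b} (f z)"
    and flim: "\<And>z. z \<in> Z \<Longrightarrow> uniform_limit {a..b} f (f z) (at z within Z)"
    and dom: "\<And>z. z \<in> Z \<Longrightarrow> increments_le (c z) (v z) a b"
    and M: "\<And>z. z \<in> Z \<Longrightarrow> v z b - v z a \<le> M"
    and c: "\<And>\<theta>. \<theta> \<in> {a..b} \<Longrightarrow> continuous_on Z (\<lambda>z. c z \<theta>)"
  shows "continuous_on Z (\<lambda>z. RS_integral (f z) (c z) a b)"
  unfolding continuous_on_def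
proof
  fix z0 assume z0: "z0 \<in> Z"
  have has: "has_RS_integral f' (c z) a b (RS_integral f' (c z) a b)"
    if "z \<in> Z" "continuous_on {a..b} f'" for z and f' :: "real \<Rightarrow> 'a"
    using has_RS_integral_exists[OF ab that(2) dom[OF that(1)]] RS_integral_eqI[OF ab] by metis
  have M0: "0 \<le> M" using M[OF z0] increments_le_mono[OF dom[OF z0], of a b] ab by simp
  show "((\<lambda>z. RS_integral (f z) (c z) a b) \<longlongrightarrow> RS_integral (f z0) (c z0) a b) (at z0 within Z)"
  proof (rule tendstoI)
    fix e :: real assume e: "e > 0"
    \<comment> \<open>\<epsilon> times a variation of at most \<open>M\<close> must stay below e/4;
      the added 1 covers M = 0.\<close>
    define \<epsilon> where "\<epsilon> = e / (4 * (M + 1))"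
    have \<epsilon>: "\<epsilon> > 0" using e M0 by (simp add: \<epsilon>_def)
    have \<epsilon>M: "\<epsilon> * (v z b - v z a) < e / 4" if "z \<in> Z" for z
    proof -
      have "\<epsilon> * (v z b - v z a) \<le> \<epsilon> * M" using M[OF that] \<epsilon> by (intro mult_left_mono) auto
      also have "\<dots> < e / 4" using e M0 by (simp add: \<epsilon>_def field_simps)
      finally show ?thesis .
    qed
    obtain \<delta> where \<delta>: "\<delta> > 0"
      and osc: "\<And>s t. s \<in> {a..b} \<Longrightarrow> t \<in> {a..b} \<Longrightarrow> \<bar>s - t\<bar> < 2 * \<delta> \<Longrightarrow> norm (f z0 s - f z0 t) \<le> \<epsilon>"
      using continuous_on_interval_oscillation[OF f[OF z0] \<epsilon>] by blast
    obtain n x where P: "fine_tagged a b \<delta> n x x" using fine_tagged_exists[OF ab \<delta>] by blast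
    have px: "is_partition a b n x" using P by (simp add: fine_tagged_def)
    have near: "norm (RS_sum (f z0) (c z) n x x - RS_integral (f z0) (c z) a b) < e / 4" if "z \<in> Z" for z
      using RS_sum_dist_integral_le[OF ab has[OF that f[OF z0]] P dom[OF that] \<delta> osc] \<epsilon>M[OF that]
      by fastforce
    have "((\<lambda>z. RS_sum (f z0) (c z) n x x) \<longlongrightarrow> RS_sum (f z0) (c z0) n x x) (at z0 within Z)"
      unfolding RS_sum_def
    proof (intro tendsto_sum tendsto_scaleR tendsto_diff tendsto_const)
      fix i assume "i \<in> {..<n}"
      then have "x i \<in> {a..b}" "x (Suc i) \<in> {a..b}"
        using is_partition_bounds[OF px, of i] is_partition_bounds[OF px, of "Suc i"] by auto
      then show "((\<lambda>z. c z (x (Suc i))) \<longlongrightarrow> c z0 (x (Suc i))) (at z0 within Z)"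
        "((\<lambda>z. c z (x i)) \<longlongrightarrow> c z0 (x i)) (at z0 within Z)"
        using c z0 by (auto simp: continuous_on_def)
    qed
    then have "\<forall>\<^sub>F z in at z0 within Z. dist (RS_sum (f z0) (c z) n x x) (RS_sum (f z0) (c z0) n x x) < e / 4"
      using e by (intro tendstoD) auto
    moreover have "\<forall>\<^sub>F z in at z0 within Z. \<forall>\<theta>\<in>{a..b}. dist (f z \<theta>) (f z0 \<theta>) < \<epsilon>"
      using uniform_limitD[OF flim[OF z0] \<epsilon>] .
    moreover have "\<forall>\<^sub>F z in at z0 within Z. z \<in> Z" by (simp add: eventually_at_filter)
    ultimately show "\<forall>\<^sub>F z in at z0 within Z.
        dist (RS_integral (f z) (c z) a b) (RS_integral (f z0) (c z0) a b) < e"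
    proof eventually_elim
      case (elim z)
      have "norm (RS_integral (f z) (c z) a b - RS_integral (f z0) (c z) a b) \<le> \<epsilon> * (v z b - v z a)"
        using elim z0 f by (intro has_RS_integral_integrand_diff_le[OF ab has has dom])
          (auto simp: dist_norm less_imp_le)
      then have "dist (RS_integral (f z) (c z) a b) (RS_integral (f z0) (c z) a b) < e / 4"
        using \<epsilon>M[OF elim(3)] by (simp add: dist_norm)
      moreover have "dist (RS_integral (f z0) (c z) a b) (RS_sum (f z0) (c z) n x x) < e / 4"
        using near[OF elim(3)] by (simp add: dist_norm norm_minus_commute)
      moreover have "dist (RS_sum (f z0) (c z0) n x x) (RS_integral (f z0) (c z0) a b) < e / 4"
        using near[OF z0] by (simp add: dist_norm)
      moreover note dist_triangle[of "RS_integral (f z) (c z) a b" "RS_sum (f z0) (c z) n x x" "RS_integral (f z0) (c z) a b"]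
        dist_triangle[of "RS_integral (f z) (c z) a b" "RS_sum (f z0) (c z0) n x x" "RS_sum (f z0) (c z) n x x"]
        dist_triangle[of "RS_integral (f z) (c z) a b" "RS_integral (f z0) (c z0) a b" "RS_sum (f z0) (c z0) n x x"]
      ultimately show ?case using elim(1) by linarith
    qed
  qed
qed

text \<open>Each term is continuous, since f z converges uniformly while the evaluation point moves.
  Near z0 all f z have a common bound, which turns the uniform Cauchy property of the absolute
  weights into that of the series.\<close>

lemma continuous_on_weighted_point_evaluations:
  fixes f :: "'z::metric_space \<Rightarrow> real \<Rightarrow> 'a::banach" and h \<tau> :: "nat \<Rightarrow> 'z \<Rightarrow> real"
  assumes f: "\<And>z. z \<in> Z \<Longrightarrow> continuous_on {a..b} (f z)"
    and flim: "\<And>z. z \<in> Z \<Longrightarrow> uniform_limit {a..b} f (f z) (at z within Z)"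
    and h: "\<And>k. continuous_on Z (h k)" and \<tau>: "\<And>k. continuous_on Z (\<tau> k)"
    and \<tau>_in: "\<And>k z. z \<in> Z \<Longrightarrow> \<tau> k z \<in> {a..b}"
    and hsum: "\<And>Y. Y \<subseteq> Z \<Longrightarrow> bounded Y \<Longrightarrow> uniformly_convergent_on Y (\<lambda>n z. \<Sum>k<n. \<bar>h k z\<bar>)"
  shows "continuous_on Z (\<lambda>z. \<Sum>k. h k z *\<^sub>R f z (\<tau> k z))"
  unfolding continuous_on_def
proof
  fix z0 assume z0: "z0 \<in> Z"
  have ft: "continuous_on Z (\<lambda>z. f z (\<tau> k z))" for k
    unfolding continuous_on_def
  proof
    fix z1 assume z1: "z1 \<in> Z"
    have inZ: "\<forall>\<^sub>F z in at z1 within Z. z \<in> Z" by (simp add: eventually_at_filter)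
    have "((\<lambda>z. f z1 (\<tau> k z)) \<longlongrightarrow> f z1 (\<tau> k z1)) (at z1 within Z)"
    proof (rule continuous_on_tendsto_compose[OF f[OF z1]])
      show "(\<tau> k \<longlongrightarrow> \<tau> k z1) (at z1 within Z)" using \<tau>[of k] z1 by (simp add: continuous_on_def)
      show "\<tau> k z1 \<in> {a..b}" by (rule \<tau>_in[OF z1])
      show "\<forall>\<^sub>F z in at z1 within Z. \<tau> k z \<in> {a..b}"
        using inZ by (rule eventually_mono) (rule \<tau>_in)
    qed
    moreover have "((\<lambda>z. f z (\<tau> k z) - f z1 (\<tau> k z)) \<longlongrightarrow> 0) (at z1 within Z)"
    proof (rule tendstoI)
      fix e :: real assume "e > 0"
      from uniform_limitD[OF flim[OF z1] this] inZ
      show "\<forall>\<^sub>F z in at z1 within Z. dist (f z (\<tau> k z) - f z1 (\<tau> k z)) 0 < e"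
      proof eventually_elim
        case (elim z)
        then show ?case using \<tau>_in[of z k] by (simp add: dist_norm)
      qed
    qed
    ultimately have "((\<lambda>z. f z1 (\<tau> k z) + (f z (\<tau> k z) - f z1 (\<tau> k z))) \<longlongrightarrow> f z1 (\<tau> k z1) + 0) (at z1 within Z)"
      by (rule tendsto_add)
    then show "((\<lambda>z. f z (\<tau> k z)) \<longlongrightarrow> f z1 (\<tau> k z1)) (at z1 within Z)" by simp
  qed
  have "bounded (f z0 ` {a..b})" using f[OF z0] by (intro compact_imp_bounded compact_continuous_image) auto
  then obtain K0 where K0: "\<And>\<theta>. \<theta> \<in> {a..b} \<Longrightarrow> norm (f z0 \<theta>) \<le> K0" unfolding bounded_iff by blast
  obtain d where d: "d > 0" "\<And>z \<theta>. z \<in> Z \<Longrightarrow> z \<noteq> z0 \<Longrightarrow> dist z z0 < d \<Longrightarrow> \<theta> \<in> {a..b} \<Longrightarrow> dist (f z \<theta>) (f z0 \<theta>) < 1"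
    using uniform_limitD[OF flim[OF z0], of 1] unfolding eventually_at by auto
  define K where "K = \<bar>K0\<bar> + 1"
  have K: "norm (f z \<theta>) \<le> K" if "z \<in> Z \<inter> ball z0 d" "\<theta> \<in> {a..b}" for z \<theta>
  proof (cases "z = z0")
    case True
    then show ?thesis using K0[OF that(2)] by (simp add: K_def)
  next
    case False
    then have "dist (f z \<theta>) (f z0 \<theta>) < 1" 
      using that by (intro d(2)) (auto simp: dist_commute)
    then show ?thesis using K0[OF that(2)] norm_triangle_sub[of "f z \<theta>" "f z0 \<theta>"]
      by (simp add: K_def dist_norm)
  qed
  have K1: "K > 0" by (simp add: K_def)
  \<comment> \<open>The ball makes the parameter set bounded, as \<open>hsum\<close> requires, and
    is the region where \<open>K\<close> bounds every f z.\<close>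
  let ?Y = "Z \<inter> ball z0 d"
  let ?S = "\<lambda>n z. \<Sum>k<n. h k z *\<^sub>R f z (\<tau> k z)"
  have "uniformly_convergent_on ?Y (\<lambda>n z. \<Sum>k<n. \<bar>h k z\<bar>)"
    by (rule hsum) (auto intro: bounded_subset[OF bounded_ball])
  then have UC: "uniformly_Cauchy_on ?Y (\<lambda>n z. \<Sum>k<n. \<bar>h k z\<bar>)"
    by (rule uniformly_convergent_Cauchy)
  have "uniformly_Cauchy_on ?Y ?S"
  proof (rule uniformly_Cauchy_onI')
    fix e :: real assume "e > 0"
    then have "e / K > 0" using K1 by simp
    with UC obtain N where N: "\<And>z m n. z \<in> ?Y \<Longrightarrow> m \<ge> N \<Longrightarrow> n \<ge> N \<Longrightarrow>
        dist (\<Sum>k<m. \<bar>h k z\<bar>) (\<Sum>k<n. \<bar>h k z\<bar>) < e / K"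
      unfolding uniformly_Cauchy_on_def by meson
    have "dist (?S m z) (?S n z) < e" if z: "z \<in> ?Y" and mn: "m \<ge> N" "n > m" for m n z
    proof -
      have split: "(\<Sum>k<n. F k) = (\<Sum>k<m. F k) + (\<Sum>k=m..<n. F k)" for F :: "nat \<Rightarrow> 'b::ab_group_add"
        using mn sum.atLeastLessThan_concat[of 0 m n F] by (simp add: atLeast0LessThan)
      have "dist (?S m z) (?S n z) = norm (\<Sum>k=m..<n. h k z *\<^sub>R f z (\<tau> k z))"
        by (simp add: split dist_norm)
      also have "\<dots> \<le> (\<Sum>k=m..<n. \<bar>h k z\<bar> * K)"
        using K[OF z] \<tau>_in z by (intro sum_norm_le) (auto intro!: mult_left_mono)
      also have "\<dots> = dist (\<Sum>k<m. \<bar>h k z\<bar>) (\<Sum>k<n. \<bar>h k z\<bar>) * K"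
        by (simp add: split dist_real_def sum_nonneg flip: sum_distrib_right)
      also have "\<dots> < e" using N[OF z, of m n] mn K1 by (simp add: field_simps)
      finally show ?thesis .
    qed
    then show "\<exists>M. \<forall>z\<in>?Y. \<forall>m\<ge>M. \<forall>n>m. dist (?S m z) (?S n z) < e" by blast
  qed
  then have "uniformly_convergent_on ?Y ?S" by (rule Cauchy_uniformly_convergent)
  then have ul: "uniform_limit ?Y ?S (\<lambda>z. lim (\<lambda>n. ?S n z)) sequentially"
    by (simp add: uniformly_convergent_uniform_limit_iff)
  have "continuous_on ?Y (\<lambda>z. lim (\<lambda>n. ?S n z))"
    by (rule uniform_limit_theorem[OF _ ul])
      (auto intro!: always_eventually continuous_intros continuous_on_subset[OF h] continuous_on_subset[OF ft])
  moreover have "at z0 within ?Y = at z0 within Z"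
    by (rule at_within_nhd[of _ "ball z0 d"]) (use d in auto)
  ultimately have "((\<lambda>z. lim (\<lambda>n. ?S n z)) \<longlongrightarrow> lim (\<lambda>n. ?S n z0)) (at z0 within Z)"
    using z0 d(1) unfolding continuous_on_def by (metis (no_types, lifting) IntI centre_in_ball)
  then show "((\<lambda>z. \<Sum>k. h k z *\<^sub>R f z (\<tau> k z)) \<longlongrightarrow> (\<Sum>k. h k z0 *\<^sub>R f z0 (\<tau> k z0))) (at z0 within Z)"
    by (simp add: suminf_eq_lim)
qed

lemma continuous_on_RS_integral:
  fixes f :: "'z::metric_space \<Rightarrow> real \<Rightarrow> 'a::banach" and g :: "'z \<Rightarrow> real \<Rightarrow> real"
    and h \<tau> :: "nat \<Rightarrow> 'z \<Rightarrow> real"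
  assumes ab: "a < b"
    and f: "\<And>z. z \<in> Z \<Longrightarrow> continuous_on {a..b} (f z)"
    and flim: "\<And>z. z \<in> Z \<Longrightarrow> uniform_limit {a..b} f (f z) (at z within Z)"
    and g: "\<And>z. z \<in> Z \<Longrightarrow> total_variation (g z) a b \<le> ereal M"
    and c: "\<And>\<theta>. \<theta> \<in> {a..b} \<Longrightarrow> continuous_on Z (\<lambda>z. cont_part (g z) a b \<theta>)"
    and h: "\<And>k. continuous_on Z (h k)" and \<tau>: "\<And>k. continuous_on Z (\<tau> k)"
    and \<tau>_in: "\<And>k z. z \<in> Z \<Longrightarrow> \<tau> k z \<in> {a..b}"
    and hsum: "\<And>Y. Y \<subseteq> Z \<Longrightarrow> bounded Y \<Longrightarrow> uniformly_convergent_on Y (\<lambda>n z. \<Sum>k<n. \<bar>h k z\<bar>)"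
    and jumps: "\<And>z \<theta>. z \<in> Z \<Longrightarrow> \<theta> \<in> {a..b} \<Longrightarrow>
      jump (jump_part (g z) a b) a b \<theta> = (\<Sum>k. if \<tau> k z = \<theta> then h k z else 0)"
  shows "continuous_on Z (\<lambda>z. RS_integral (f z) (g z) a b)"
proof -
  \<comment> \<open>All facts about \<open>v\<close> and \<open>w\<close> are bundled, so that a
    single choice over z yields one consistent pair.\<close>
  define P where "P z v w \<longleftrightarrow> increments_le (g z) v a b \<and> v b - v a \<le> M \<and>
      increments_le (jump_part (g z) a b) w a b \<and> w b - w a \<le> v b - v a \<and>
      has_RS_integral (f z) (jump_part (g z) a b) a b (\<Sum>k. h k z *\<^sub>R f z (\<tau> k z))" for z v w
  have "\<exists>v w. P z v w" if z: "z \<in> Z" for z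
  proof -
    obtain v where v: "increments_le (g z) v a b" "v b - v a \<le> M"
      using total_variation_imp_increments_le[OF _ g[OF z]] ab by (metis less_imp_le)
    interpret dominated_increments "g z" v a b by unfold_locales (use ab v in auto)
    \<comment> \<open>Uniform convergence on a singleton is absolute summability at z.\<close>
    have "uniformly_convergent_on {z} (\<lambda>n z. \<Sum>k<n. \<bar>h k z\<bar>)" using z by (intro hsum) auto
    then have "convergent (\<lambda>n. \<Sum>k<n. \<bar>h k z\<bar>)" by (rule uniformly_convergent_imp_convergent) simp
    then have sm: "summable (\<lambda>k. \<bar>h k z\<bar>)" by (simp add: summable_iff_convergent)
    have "bounded (f z ` {a..b})" using f[OF z] by (intro compact_imp_bounded compact_continuous_image) auto
    then obtain K where K: "\<And>\<theta>. \<theta> \<in> {a..b} \<Longrightarrow> norm (f z \<theta>) \<le> K" unfolding bounded_iff by blast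
    have "infsum (\<lambda>y. jump s a b y *\<^sub>R f z y) {a..b}
        = infsum (\<lambda>y. (\<Sum>k. if \<tau> k z = y then h k z else 0) *\<^sub>R f z y) {a..b}"
      by (intro infsum_cong) (simp add: jumps[OF z])
    also have "\<dots> = (\<Sum>k. h k z *\<^sub>R f z (\<tau> k z))"
      by (rule infsum_grouped_by_location[OF sm \<tau>_in[OF z] K])
    finally have "has_RS_integral (f z) s a b (\<Sum>k. h k z *\<^sub>R f z (\<tau> k z))"
      using has_RS_integral_jump_part[OF f[OF z]] by simp
    then show ?thesis using v increments_le_jump_part w_total_le unfolding P_def by blast
  qed
  then obtain v w where "\<And>z. z \<in> Z \<Longrightarrow> P z (v z) (w z)" by metis
  then have v: "\<And>z. z \<in> Z \<Longrightarrow> increments_le (g z) (v z) a b"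
    and M: "\<And>z. z \<in> Z \<Longrightarrow> v z b - v z a \<le> M"
    and w: "\<And>z. z \<in> Z \<Longrightarrow> increments_le (jump_part (g z) a b) (w z) a b"
    and wv: "\<And>z. z \<in> Z \<Longrightarrow> w z b - w z a \<le> v z b - v z a"
    and int: "\<And>z. z \<in> Z \<Longrightarrow> has_RS_integral (f z) (jump_part (g z) a b) a b (\<Sum>k. h k z *\<^sub>R f z (\<tau> k z))"
    by (simp_all add: P_def)
  have dom: "increments_le (cont_part (g z) a b) (\<lambda>x. v z x + w z x) a b" if "z \<in> Z" for z
    using increments_le_diff[OF v[OF that] w[OF that]] by (simp add: cont_part_def[abs_def])
  have "continuous_on Z (\<lambda>z. RS_integral (f z) (cont_part (g z) a b) a b + (\<Sum>k. h k z *\<^sub>R f z (\<tau> k z)))"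
  proof (rule continuous_on_add)
    show "continuous_on Z (\<lambda>z. RS_integral (f z) (cont_part (g z) a b) a b)"
    proof (rule continuous_on_RS_integral_dominated[OF ab f flim dom _ c])
      \<comment> \<open>The continuous part is dominated by v + w, and each summand has total
        increment at most \<open>M\<close>.\<close>
      fix z assume "z \<in> Z"
      then show "v z b + w z b - (v z a + w z a) \<le> 2 * M" using M[of z] wv[of z] by linarith
    qed
    show "continuous_on Z (\<lambda>z. \<Sum>k. h k z *\<^sub>R f z (\<tau> k z))"
      by (rule continuous_on_weighted_point_evaluations[OF f flim h \<tau> \<tau>_in hsum])
  qed
  moreover have "RS_integral (f z) (g z) a b
      = RS_integral (f z) (cont_part (g z) a b) a b + (\<Sum>k. h k z *\<^sub>R f z (\<tau> k z))" if z: "z \<in> Z" for z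
  proof (rule RS_integral_eqI[OF ab])
    obtain I where I: "has_RS_integral (f z) (cont_part (g z) a b) a b I"
      using has_RS_integral_exists[OF ab f[OF z] dom[OF z]] .
    have "has_RS_integral (f z) (\<lambda>x. cont_part (g z) a b x + jump_part (g z) a b x) a b (I + (\<Sum>k. h k z *\<^sub>R f z (\<tau> k z)))"
      by (rule has_RS_integral_add[OF I int[OF z]])
    then show "has_RS_integral (f z) (g z) a b
      (RS_integral (f z) (cont_part (g z) a b) a b + (\<Sum>k. h k z *\<^sub>R f z (\<tau> k z)))"
      by (simp add: cont_part_def RS_integral_eqI[OF ab I])
  qed
  ultimately show ?thesis by (simp cong: continuous_on_cong)
qed

section \<open>Compact semigroups and convolutions\<close>

text \<open>The compact set may depend on e: a finite e/3-net of it is an e-net of the closure of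
  \<open>W\<close>, so that closure is totally bounded.\<close>

lemma compact_closure_approx:
  fixes W :: "'a::complete_space set"
  assumes approx: "\<And>e. e > 0 \<Longrightarrow> \<exists>C. compact C \<and> (\<forall>w\<in>W. \<exists>c\<in>C. dist w c < e)"
  shows "compact (closure W)"
  unfolding compact_eq_totally_bounded
proof (intro conjI allI impI)
  show "complete (closure W)" by (simp add: complete_eq_closed)
  fix e :: real assume "e > 0"
  then obtain C where C: "compact C" "\<And>w. w \<in> W \<Longrightarrow> \<exists>c\<in>C. dist w c < e / 3"
    using approx[of "e / 3"] by auto
  obtain k where k: "finite k" "C \<subseteq> (\<Union>x\<in>k. ball x (e / 3))"
    using C(1) \<open>e > 0\<close> unfolding compact_eq_totally_bounded by (metis zero_less_divide_iff zero_less_numeral)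
  have "closure W \<subseteq> (\<Union>x\<in>k. ball x e)"
  proof
    fix y assume "y \<in> closure W"
    then obtain w where w: "w \<in> W" "dist w y < e / 3"
      using \<open>e > 0\<close> unfolding closure_approachable by (metis zero_less_divide_iff zero_less_numeral)
    obtain c where c: "c \<in> C" "dist w c < e / 3" using C(2)[OF w(1)] by blast
    obtain x where x: "x \<in> k" "dist x c < e / 3" using k(2) c(1) by auto
    have "dist x y \<le> dist x c + dist w c + dist w y"
      using dist_triangle[of x y c] dist_triangle2[of c y w] by (simp add: dist_commute)
    then have "dist x y < e" using w c x by linarith
    then show "y \<in> (\<Union>x\<in>k. ball x e)" using x by auto
  qed
  then show "\<exists>k. finite k \<and> closure W \<subseteq> (\<Union>x\<in>k. ball x e)" using k(1) by blast
qed

text \<open>This is the Arzela-Ascoli theorem for maps into a compact set. Sequential compactness of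
  a countable product of copies of \<open>C\<close> takes the place of the diagonal
  argument.\<close>

lemma equicontinuous_compact_subsequence:
  fixes v :: "nat \<Rightarrow> real \<Rightarrow> 'a::complete_space"
  assumes "a \<le> b" and C: "compact C" and vC: "\<And>n t. t \<in> {a..b} \<Longrightarrow> v n t \<in> C"
    and equi: "\<And>e. e > 0 \<Longrightarrow> \<exists>d>0. \<forall>n. \<forall>s\<in>{a..b}. \<forall>t\<in>{a..b}. \<bar>s - t\<bar> < d \<longrightarrow> dist (v n s) (v n t) < e"
  obtains k :: "nat \<Rightarrow> nat" and l where "strict_mono k" "uniform_limit {a..b} (\<lambda>n. v (k n)) l sequentially"
proof -
  \<comment> \<open>Clipping sends every rational into [a,b], which gives dense sample points
    indexed by a countable type.\<close>
  define c where "c q = clip a b (of_rat q)" for q :: rat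
  have c: "c q \<in> {a..b}" for q using assms(1) by (auto simp: c_def clip_def)
  define w where "w n = (\<lambda>q. v n (c q))" for n
  have "compactin (product_topology (\<lambda>i::rat. euclidean :: 'a topology) UNIV) (PiE UNIV (\<lambda>_. C))"
    using C by (simp add: compactin_PiE)
  then have "compact (PiE UNIV (\<lambda>_. C) :: (rat \<Rightarrow> 'a) set)"
    by (simp add: euclidean_product_topology)
  \<comment> \<open>Countability of \<open>rat\<close> makes the product first countable, so that
    compactness yields convergent subsequences.\<close>
  then have "seq_compact (PiE UNIV (\<lambda>_. C) :: (rat \<Rightarrow> 'a) set)"
    by (rule compact_imp_seq_compact)
  moreover have "\<forall>n. w n \<in> PiE UNIV (\<lambda>_. C)" using vC c by (auto simp: w_def)
  ultimately obtain L k where k: "strict_mono k" "(w \<circ> k) \<longlonglongrightarrow> L"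
    unfolding seq_compact_def by meson
  have lim: "(\<lambda>n. v (k n) (c q)) \<longlonglongrightarrow> L q" for q
    using continuous_on_tendsto_compose[OF continuous_on_product_coordinates[of q] k(2)]
    by (simp add: w_def)
  have "uniformly_Cauchy_on {a..b} (\<lambda>n. v (k n))"
  proof (rule uniformly_Cauchy_onI)
    fix e :: real assume "e > 0"
    then have e3: "e / 3 > 0" by simp
    obtain d where d: "d > 0" "\<And>n s t. s \<in> {a..b} \<Longrightarrow> t \<in> {a..b} \<Longrightarrow> \<bar>s - t\<bar> < d \<Longrightarrow> dist (v n s) (v n t) < e / 3"
      using equi[OF e3] by blast
    have "{a..b} \<subseteq> (\<Union>q\<in>UNIV. ball (c q) d)"
    proof
      fix t assume t: "t \<in> {a..b}"
      obtain q where q: "t - d < of_rat q" "of_rat q < t + d"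
        using of_rat_dense[of "t - d" "t + d"] d(1) by auto
      then have "\<bar>c q - t\<bar> < d" using t d(1) by (auto simp: c_def clip_def max_def min_def)
      then show "t \<in> (\<Union>q\<in>UNIV. ball (c q) d)" by (auto simp: dist_real_def)
    qed
    then obtain Q where Q: "finite Q" "{a..b} \<subseteq> (\<Union>q\<in>Q. ball (c q) d)"
      using compactE_image[of "{a..b}" UNIV "\<lambda>q. ball (c q) d"] by (metis compact_Icc open_ball)
    have "\<exists>M. \<forall>m\<ge>M. \<forall>n\<ge>M. dist (v (k m) (c q)) (v (k n) (c q)) < e / 3" for q
      using LIMSEQ_imp_Cauchy[OF lim[of q]] e3 unfolding Cauchy_def by blast
    then obtain M where M: "\<And>q m n. m \<ge> M q \<Longrightarrow> n \<ge> M q \<Longrightarrow> dist (v (k m) (c q)) (v (k n) (c q)) < e / 3"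
      by metis
    define N where "N = Max (insert 0 (M ` Q))"
    have N: "M q \<le> N" if "q \<in> Q" for q unfolding N_def using Q that by (intro Max_ge) auto
    have "dist (v (k m) t) (v (k n) t) < e" if t: "t \<in> {a..b}" and mn: "m \<ge> N" "n \<ge> N" for t m n
    proof -
      obtain q where q: "q \<in> Q" "\<bar>c q - t\<bar> < d" using Q(2) t by (auto simp: dist_real_def)
      have "dist (v (k m) (c q)) (v (k m) t) < e / 3" "dist (v (k n) (c q)) (v (k n) t) < e / 3"
        by (rule d(2)[OF c t q(2)])+
      moreover have "dist (v (k m) (c q)) (v (k n) (c q)) < e / 3"
        using M N[OF q(1)] mn by (meson order_trans)
      ultimately show ?thesis
        using dist_triangle[of "v (k m) t" "v (k n) t" "v (k n) (c q)"]
          dist_triangle[of "v (k m) t" "v (k n) (c q)" "v (k m) (c q)"] by (simp add: dist_commute)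
    qed
    then show "\<exists>M. \<forall>t\<in>{a..b}. \<forall>m\<ge>M. \<forall>n\<ge>M. dist (v (k m) t) (v (k n) t) < e" by blast
  qed
  then have "uniformly_convergent_on {a..b} (\<lambda>n. v (k n))" by (rule Cauchy_uniformly_convergent)
  then show thesis using that k(1) unfolding uniformly_convergent_on_def by blast
qed

section \<open>Strong continuity of the semigroup\<close>

locale quasicontractive_semigroup =
  fixes S :: "real \<Rightarrow> ('a::banach \<Rightarrow>\<^sub>L 'a)" and \<omega> :: real
  assumes C0: "C0_semigroup S"
    and growth: "\<And>t. t \<ge> 0 \<Longrightarrow> norm (S t) \<le> exp (\<omega> * t)"
begin

lemma S_0: "S 0 x = x"
  using C0 by (simp add: C0_semigroup_def)

lemma S_add: "t \<ge> 0 \<Longrightarrow> s \<ge> 0 \<Longrightarrow> S (t + s) x = S t (S s x)"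
  using C0 by (simp add: C0_semigroup_def blinfun_compose.rep_eq)

text \<open>The absolute value makes the exponent nondecreasing in time for either sign of \<omega>,
  hence one constant for all of [0,T].\<close>

lemma norm_S_apply_le:
  assumes "0 \<le> t" "t \<le> T"
  shows "norm (S t x) \<le> exp (\<bar>\<omega>\<bar> * T) * norm x"
proof -
  have "\<omega> * t \<le> \<bar>\<omega>\<bar> * T" using assms by (intro mult_mono) auto
  then have "norm (S t) \<le> exp (\<bar>\<omega>\<bar> * T)" using growth[OF assms(1)] by (simp add: order_trans)
  then show ?thesis using norm_blinfun[of "S t" x] by (meson mult_right_mono norm_ge_zero order_trans)
qed

lemma S_near_0:
  assumes "e > 0"
  obtains d where "d > 0" "\<And>h. 0 \<le> h \<Longrightarrow> h < d \<Longrightarrow> norm (S h x - x) < e"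
proof -
  have "((\<lambda>t. S t x) \<longlongrightarrow> x) (at_right 0)" using C0 by (simp add: C0_semigroup_def)
  then have "\<forall>\<^sub>F t in at_right 0. dist (S t x) x < e" using assms by (rule tendstoD)
  then obtain d where d: "d > 0" "\<And>h. 0 < h \<Longrightarrow> h < d \<Longrightarrow> dist (S h x) x < e"
    unfolding eventually_at_right_field by auto
  show thesis
  proof (rule that[OF d(1)])
    fix h :: real assume "0 \<le> h" "h < d"
    then show "norm (S h x - x) < e"
      using d(2)[of h] assms by (cases "h = 0") (auto simp: S_0 dist_norm)
  qed
qed

text \<open>Continuity at 0 from the right is all that is given. With m the smaller time and h the
  distance of the two times, the difference of the values is S m (S h x - x) up to sign, and S m is
  bounded for times up to t + 1. This gives both one-sided limits at once.\<close>

lemma continuous_on_orbit: "continuous_on {0..} (\<lambda>t. S t x)"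
  unfolding continuous_on_iff
proof (intro ballI allI impI)
  fix t e :: real assume t: "t \<in> {0..}" and e: "e > 0"
  define E where "E = exp (\<bar>\<omega>\<bar> * (t + 1))"
  have E: "E > 0" by (simp add: E_def)
  obtain d where d: "d > 0" "\<And>h. 0 \<le> h \<Longrightarrow> h < d \<Longrightarrow> norm (S h x - x) < e / E"
    using S_near_0[of "e / E" x] e E by auto
  have "dist (S t' x) (S t x) < e" if t': "t' \<in> {0..}" "dist t' t < min d 1" for t'
  proof -
    define m h where "m = min t t'" and "h = \<bar>t' - t\<bar>"
    have m: "0 \<le> m" "m \<le> t + 1" and h: "0 \<le> h" "h < d"
      using t t' by (auto simp: m_def h_def dist_real_def)
    have "S (m + h) x = S m (S h x)" using m h by (intro S_add) auto
    moreover have "norm (S t' x - S t x) = norm (S (m + h) x - S m x)"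
      by (auto simp: m_def h_def min_def abs_if norm_minus_commute)
    ultimately have "norm (S t' x - S t x) = norm (S m (S h x - x))"
      by (simp add: blinfun.diff_right)
    also have "\<dots> \<le> E * norm (S h x - x)" unfolding E_def using m by (intro norm_S_apply_le)
    also have "\<dots> < e" using d(2)[OF h] E by (simp add: field_simps)
    finally show ?thesis by (simp add: dist_norm)
  qed
  then show "\<exists>d>0. \<forall>t'\<in>{0..}. dist t' t < d \<longrightarrow> dist (S t' x) (S t x) < e"
    using d(1) by (intro exI[of _ "min d 1"]) auto
qed

text \<open>Only strong continuity is at hand, so the moving argument is separated: the growth bound
  handles S (\<tau> s) applied to f s - f s0, and the orbit of f s0 handles the rest.\<close>

lemma continuous_on_S_apply:
  fixes f :: "'b::topological_space \<Rightarrow> 'a"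
  assumes \<tau>: "continuous_on A \<tau>" "\<And>s. s \<in> A \<Longrightarrow> \<tau> s \<ge> 0" and f: "continuous_on A f"
  shows "continuous_on A (\<lambda>s. S (\<tau> s) (f s))"
  unfolding continuous_on_def
proof
  fix s0 assume s0: "s0 \<in> A"
  let ?F = "at s0 within A"
  have inA: "\<forall>\<^sub>F s in ?F. s \<in> A" by (simp add: eventually_at_filter)
  have \<tau>lim: "(\<tau> \<longlongrightarrow> \<tau> s0) ?F" and flim: "(f \<longlongrightarrow> f s0) ?F"
    using \<tau>(1) f s0 by (auto simp: continuous_on_def)
  have "((\<lambda>s. exp (\<omega> * \<tau> s) * norm (f s - f s0)) \<longlongrightarrow> exp (\<omega> * \<tau> s0) * norm (f s0 - f s0)) ?F"
    by (intro tendsto_intros \<tau>lim flim)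
  then have "((\<lambda>s. exp (\<omega> * \<tau> s) * norm (f s - f s0)) \<longlongrightarrow> 0) ?F" by simp
  then have "((\<lambda>s. S (\<tau> s) (f s - f s0)) \<longlongrightarrow> 0) ?F"
  proof (rule Lim_null_comparison[rotated])
    show "\<forall>\<^sub>F s in ?F. norm (S (\<tau> s) (f s - f s0)) \<le> exp (\<omega> * \<tau> s) * norm (f s - f s0)"
      using inA
    proof eventually_elim
      case (elim s)
      then show ?case using norm_blinfun[of "S (\<tau> s)" "f s - f s0"] growth[OF \<tau>(2)[OF elim]]
        by (meson mult_right_mono norm_ge_zero order_trans)
    qed
  qed
  moreover have "((\<lambda>s. S (\<tau> s) (f s0)) \<longlongrightarrow> S (\<tau> s0) (f s0)) ?F"
    by (rule continuous_on_tendsto_compose[OF continuous_on_orbit \<tau>lim])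
      (use \<tau>(2) s0 inA in \<open>auto elim: eventually_mono\<close>)
  ultimately have "((\<lambda>s. S (\<tau> s) (f s - f s0) + S (\<tau> s) (f s0)) \<longlongrightarrow> 0 + S (\<tau> s0) (f s0)) ?F"
    by (rule tendsto_add)
  then show "((\<lambda>s. S (\<tau> s) (f s)) \<longlongrightarrow> S (\<tau> s0) (f s0)) ?F"
    by (simp add: blinfun.diff_right)
qed

text \<open>Joint continuity is uniform on the compact product of [0,1] and \<open>C\<close>;
  compare (h,x) with (0,x).\<close>

lemma S_near_0_uniform:
  assumes "compact C" "e > 0"
  obtains d where "d > 0" "\<And>h x. 0 \<le> h \<Longrightarrow> h < d \<Longrightarrow> x \<in> C \<Longrightarrow> norm (S h x - x) < e"
proof -
  have "continuous_on ({0..1} \<times> C) (\<lambda>z. S (fst z) (snd z))"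
    by (rule continuous_on_S_apply) (auto intro!: continuous_intros)
  moreover have "compact ({0..1::real} \<times> C)" using assms(1) by (intro compact_Times) auto
  ultimately have "uniformly_continuous_on ({0..1} \<times> C) (\<lambda>z. S (fst z) (snd z))"
    by (rule compact_uniformly_continuous)
  then obtain d where d: "d > 0" "\<And>z z'. z \<in> {0..1} \<times> C \<Longrightarrow> z' \<in> {0..1} \<times> C \<Longrightarrow> dist z' z < d \<Longrightarrow>
      dist (S (fst z') (snd z')) (S (fst z) (snd z)) < e"
    using assms(2) unfolding uniformly_continuous_on_def by meson
  show thesis
  proof (rule that[of "min d 1"])
    fix h :: real and x assume *: "0 \<le> h" "h < min d 1" "x \<in> C"
    then have "dist (S (fst (h, x)) (snd (h, x))) (S (fst (0::real, x)) (snd (0::real, x))) < e"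
      by (intro d(2)) (auto simp: dist_Pair_Pair dist_real_def)
    then show "norm (S h x - x) < e" by (simp add: dist_norm S_0)
  qed (use d in auto)
qed

section \<open>Duhamel integrals\<close>

definition conv :: "real \<Rightarrow> (real \<Rightarrow> 'a) \<Rightarrow> real \<Rightarrow> 'a" where
  "conv a f t = integral {a..t} (\<lambda>s. S (t - s) (f s))"

lemma continuous_on_conv_integrand:
  assumes "continuous_on {a..b} f" "{c..d} \<subseteq> {a..b}" "d \<le> t"
  shows "continuous_on {c..d} (\<lambda>s. S (t - s) (f s))"
  using assms by (intro continuous_on_S_apply continuous_on_subset[OF assms(1)] continuous_intros) auto

lemma norm_integral_S_le:
  assumes "continuous_on {a..b} f" "\<And>s. s \<in> {a..b} \<Longrightarrow> norm (f s) \<le> K"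
    and "a \<le> c" "c \<le> d" "d \<le> t" "t \<le> b"
  shows "norm (integral {c..d} (\<lambda>s. S (t - s) (f s))) \<le> exp (\<bar>\<omega>\<bar> * (b - a)) * K * (d - c)"
proof (rule integral_bound)
  show "continuous_on {c..d} (\<lambda>s. S (t - s) (f s))"
    using assms by (intro continuous_on_conv_integrand[OF assms(1)]) auto
  fix s assume "s \<in> {c..d}"
  then have "norm (S (t - s) (f s)) \<le> exp (\<bar>\<omega>\<bar> * (b - a)) * norm (f s)" "norm (f s) \<le> K"
    using assms by (auto intro!: norm_S_apply_le)
  then show "norm (S (t - s) (f s)) \<le> exp (\<bar>\<omega>\<bar> * (b - a)) * K"
    by (meson exp_ge_zero mult_left_mono order_trans)
qed (use assms in auto)

lemma norm_conv_le:
  assumes "continuous_on {a..b} f" "\<And>s. s \<in> {a..b} \<Longrightarrow> norm (f s) \<le> K" "a \<le> t" "t \<le> b"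
  shows "norm (conv a f t) \<le> exp (\<bar>\<omega>\<bar> * (b - a)) * K * (t - a)"
  unfolding conv_def using assms by (intro norm_integral_S_le) auto

text \<open>On the past [a,t] the operator S (t' - s) factors as S (t' - t) after S (t - s), and the
  bounded operator S (t' - t) commutes with the integral.\<close>

lemma conv_increment:
  assumes f: "continuous_on {a..b} f" and t: "a \<le> t" "t \<le> t'" "t' \<le> b"
  shows "conv a f t' = S (t' - t) (conv a f t) + integral {t..t'} (\<lambda>s. S (t' - s) (f s))"
proof -
  have "conv a f t' = integral {a..t} (\<lambda>s. S (t' - s) (f s)) + integral {t..t'} (\<lambda>s. S (t' - s) (f s))"
    unfolding conv_def using t
    by (intro Henstock_Kurzweil_Integration.integral_combine[symmetric] integrable_continuous_interval
        continuous_on_conv_integrand[OF f]) auto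
  also have "integral {a..t} (\<lambda>s. S (t' - s) (f s)) = integral {a..t} (S (t' - t) \<circ> (\<lambda>s. S (t - s) (f s)))"
  proof (rule integral_cong)
    fix s assume "s \<in> {a..t}"
    then show "S (t' - s) (f s) = (S (t' - t) \<circ> (\<lambda>s. S (t - s) (f s))) s"
      using t S_add[of "t' - t" "t - s" "f s"] by simp
  qed
  also have "\<dots> = S (t' - t) (conv a f t)"
    unfolding conv_def using t
    by (intro integral_linear integrable_continuous_interval continuous_on_conv_integrand[OF f]
        blinfun.bounded_linear_right) auto
  finally show ?thesis .
qed

end

section \<open>Compactness and equicontinuity of Duhamel integrals\<close>

locale compact_quasicontractive_semigroup = quasicontractive_semigroup +
  assumes compact_S: "\<And>t. t > 0 \<Longrightarrow> compact_operator (S t)"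
begin

lemma S_bounded_subset_compact:
  assumes "h > 0" "R > 0"
  obtains C where "compact C" "\<And>x. norm x < R \<Longrightarrow> S h x \<in> C"
proof (rule that)
  show "compact ((\<lambda>y. R *\<^sub>R y) ` closure (S h ` ball 0 1))"
    using compact_S[OF assms(1)] unfolding compact_operator_def by (rule compact_scaling)
  fix x :: 'a assume "norm x < R"
  then have "x /\<^sub>R R \<in> ball 0 1" using assms(2) by (auto simp: field_simps)
  moreover have "S h x = R *\<^sub>R S h (x /\<^sub>R R)" using assms(2) by (simp add: blinfun.scaleR_right)
  ultimately show "S h x \<in> (\<lambda>y. R *\<^sub>R y) ` closure (S h ` ball 0 1)"
    by (simp only:) (intro imageI closure_subset[THEN subsetD])
qed

text \<open>Up to an error \<open>O(h)\<close>, a convolution at time \<open>t\<close> is \<open>S h\<close> applied to the convolution at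
  time \<open>t - h\<close>; so the compact operator \<open>S h\<close> controls all values at once.\<close>

lemma compact_closure_conv_values:
  assumes ab: "a \<le> b"
    and f: "\<And>i. i \<in> I \<Longrightarrow> continuous_on {a..b} (f i)"
    and K: "\<And>i s. i \<in> I \<Longrightarrow> s \<in> {a..b} \<Longrightarrow> norm (f i s) \<le> K"
  shows "compact (closure {conv a (f i) t |i t. i \<in> I \<and> t \<in> {a..b}})"
proof (rule compact_closure_approx)
  fix e :: real assume e: "e > 0"
  \<comment> \<open>The absolute value and the added 1 give Q \<ge> 1 whatever the sign of
    \<open>K\<close> (the family may be empty), so one can divide by Q; then Q h = e/2.\<close>
  define Q where "Q = exp (\<bar>\<omega>\<bar> * (b - a)) * \<bar>K\<bar> + 1"
  define h where "h = e / (2 * Q)"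
  define R where "R = Q * (b - a) + 1"
  have Q: "Q \<ge> 1" by (simp add: Q_def)
  have h: "h > 0" using e Q by (simp add: h_def)
  have Qh: "Q * h < e" using e Q by (simp add: h_def field_simps)
  have R: "R > 0" using Q ab by (simp add: R_def add_nonneg_pos)
  have KQ: "exp (\<bar>\<omega>\<bar> * (b - a)) * K * x \<le> Q * x" if "x \<ge> 0" for x
    unfolding Q_def using that by (intro mult_right_mono) (auto intro: add_increasing2 mult_left_mono)
  obtain C where C: "compact C" "\<And>x. norm x < R \<Longrightarrow> S h x \<in> C"
    using S_bounded_subset_compact[OF h R] by blast
  have "\<exists>c\<in>insert 0 C. dist (conv a (f i) t) c < e" if i: "i \<in> I" and t: "t \<in> {a..b}" for i t
  proof (cases "t < a + h")
    \<comment> \<open>Here t - h would lie to the left of \<open>a\<close>. The integral runs over a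
      length below h and is itself small, so 0 approximates it; this is why 0 is inserted into
      \<open>C\<close>.\<close>
    case True
    have "norm (conv a (f i) t) \<le> Q * (t - a)"
      using norm_conv_le[OF f[OF i] K[OF i], of t] KQ[of "t - a"] t by auto
    also have "\<dots> \<le> Q * h" using True Q by (intro mult_left_mono) auto
    finally show ?thesis using Qh by auto
  next
    case False
    have "norm (conv a (f i) (t - h)) \<le> Q * (t - h - a)"
      using norm_conv_le[OF f[OF i] K[OF i], of "t - h"] KQ[of "t - h - a"] t h False by auto
    also have "\<dots> \<le> Q * (b - a)" using t h Q by (intro mult_left_mono) auto
    finally have "S h (conv a (f i) (t - h)) \<in> C" by (intro C(2)) (simp add: R_def)
    moreover have "norm (conv a (f i) t - S h (conv a (f i) (t - h))) \<le> Q * h"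
    proof -
      have "norm (integral {t - h..t} (\<lambda>s. S (t - s) (f i s)))
          \<le> exp (\<bar>\<omega>\<bar> * (b - a)) * K * (t - (t - h))"
        using t h False by (intro norm_integral_S_le[OF f[OF i] K[OF i]]) auto
      also have "\<dots> \<le> Q * (t - (t - h))" using h by (intro KQ) simp
      finally show ?thesis using conv_increment[OF f[OF i], of "t - h" t] t h False by simp
    qed
    ultimately show ?thesis
      using Qh by (intro bexI[of _ "S h (conv a (f i) (t - h))"]) (auto simp: dist_norm)
  qed
  then show "\<exists>C. compact C \<and> (\<forall>w\<in>{conv a (f i) t |i t. i \<in> I \<and> t \<in> {a..b}}. \<exists>c\<in>C. dist w c < e)"
    using C(1) by (intro exI[of _ "insert 0 C"]) auto
qed

text \<open>By \<open>conv_increment\<close> a difference is S (t' - t) minus the identity, applied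
  to a point of the compact set of values, plus an integral over [t,t'] of norm at most Q (t' - t).
  Each part gets e/2.\<close>

lemma conv_equicontinuous:
  assumes ab: "a \<le> b"
    and f: "\<And>i. i \<in> I \<Longrightarrow> continuous_on {a..b} (f i)"
    and K: "\<And>i s. i \<in> I \<Longrightarrow> s \<in> {a..b} \<Longrightarrow> norm (f i s) \<le> K" and e: "e > 0"
  shows "\<exists>d>0. \<forall>i\<in>I. \<forall>s\<in>{a..b}. \<forall>t\<in>{a..b}. \<bar>s - t\<bar> < d \<longrightarrow> dist (conv a (f i) s) (conv a (f i) t) < e"
proof -
  define W where "W = {conv a (f i) t |i t. i \<in> I \<and> t \<in> {a..b}}"
  have W: "compact (closure W)" unfolding W_def by (rule compact_closure_conv_values[OF ab f K])
  have inW: "conv a (f i) t \<in> closure W" if "i \<in> I" "t \<in> {a..b}" for i t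
    using that closure_subset[of W] by (auto simp: W_def)
  define Q where "Q = exp (\<bar>\<omega>\<bar> * (b - a)) * \<bar>K\<bar> + 1"
  have Q: "Q \<ge> 1" by (simp add: Q_def)
  have KQ: "exp (\<bar>\<omega>\<bar> * (b - a)) * K * x \<le> Q * x" if "x \<ge> 0" for x
    unfolding Q_def using that by (intro mult_right_mono) (auto intro: add_increasing2 mult_left_mono)
  obtain d where d: "d > 0" "\<And>h x. 0 \<le> h \<Longrightarrow> h < d \<Longrightarrow> x \<in> closure W \<Longrightarrow> norm (S h x - x) < e / 2"
    using S_near_0_uniform[OF W, of "e / 2"] e by auto
  define d' where "d' = min d (e / (2 * Q))"
  have d': "d' > 0" using d e Q by (simp add: d'_def)
  have le: "dist (conv a (f i) t) (conv a (f i) t') < e"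
    if i: "i \<in> I" and t: "a \<le> t" "t \<le> t'" "t' \<le> b" "t' - t < d'" for i t t'
  proof -
    have "norm (S (t' - t) (conv a (f i) t) - conv a (f i) t) < e / 2"
      using i t by (intro d(2) inW) (auto simp: d'_def)
    moreover have "norm (integral {t..t'} (\<lambda>s. S (t' - s) (f i s))) \<le> Q * (t' - t)"
    proof -
      have "norm (integral {t..t'} (\<lambda>s. S (t' - s) (f i s))) \<le> exp (\<bar>\<omega>\<bar> * (b - a)) * K * (t' - t)"
        using t by (intro norm_integral_S_le[OF f[OF i] K[OF i]]) auto
      also have "\<dots> \<le> Q * (t' - t)" using t by (intro KQ) simp
      finally show ?thesis .
    qed
    moreover have "Q * (t' - t) < e / 2" using t(4) Q by (simp add: d'_def field_simps)
    ultimately have "norm (S (t' - t) (conv a (f i) t) - conv a (f i) t)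
       + norm (integral {t..t'} (\<lambda>s. S (t' - s) (f i s))) < e" by linarith
    moreover have "conv a (f i) t' - conv a (f i) t = (S (t' - t) (conv a (f i) t) - conv a (f i) t)
       + integral {t..t'} (\<lambda>s. S (t' - s) (f i s))"
      using conv_increment[OF f[OF i] t(1-3)] by simp
    ultimately have "norm (conv a (f i) t' - conv a (f i) t) < e"
      by (simp only:) (rule norm_triangle_lt)
    then show ?thesis by (simp add: dist_norm norm_minus_commute)
  qed
  have "dist (conv a (f i) s) (conv a (f i) t) < e"
    if "i \<in> I" "s \<in> {a..b}" "t \<in> {a..b}" "\<bar>s - t\<bar> < d'" for i s t
    using le[of i s t] le[of i t s] that by (cases "s \<le> t") (auto simp: dist_commute)
  then show ?thesis using d' by blast
qed

text \<open>Equicontinuity of a one-element family.\<close>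

lemma continuous_on_conv:
  assumes "a \<le> b" and f: "continuous_on {a..b} f"
  shows "continuous_on {a..b} (conv a f)"
proof -
  have "bounded (f ` {a..b})" using f by (intro compact_imp_bounded compact_continuous_image) auto
  then obtain K where K: "\<And>s. s \<in> {a..b} \<Longrightarrow> norm (f s) \<le> K" unfolding bounded_iff by blast
  have "uniformly_continuous_on {a..b} (conv a f)"
    unfolding uniformly_continuous_on_def
  proof (intro allI impI)
    fix e :: real assume "e > 0"
    then obtain d where "d > 0"
      "\<And>s t. s \<in> {a..b} \<Longrightarrow> t \<in> {a..b} \<Longrightarrow> \<bar>s - t\<bar> < d \<Longrightarrow> dist (conv a f s) (conv a f t) < e"
      using conv_equicontinuous[of a b "{()}" "\<lambda>_. f" K e] assms K by auto
    then show "\<exists>d>0. \<forall>t\<in>{a..b}. \<forall>s\<in>{a..b}. dist s t < d \<longrightarrow> dist (conv a f s) (conv a f t) < e"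
      by (auto simp: dist_real_def)
  qed
  then show ?thesis by (rule uniformly_continuous_imp_continuous)
qed

lemma conv_convergent_subsequence:
  fixes f :: "nat \<Rightarrow> real \<Rightarrow> 'a"
  assumes ab: "a \<le> b"
    and f: "\<And>n. continuous_on {a..b} (f n)"
    and K: "\<And>n s. s \<in> {a..b} \<Longrightarrow> norm (f n s) \<le> K"
  obtains k :: "nat \<Rightarrow> nat" and l where "strict_mono k" "uniform_limit {a..b} (\<lambda>n. conv a (f (k n))) l sequentially"
proof -
  define W where "W = {conv a (f n) t |n t. n \<in> UNIV \<and> t \<in> {a..b}}"
  have W: "compact (closure W)" unfolding W_def by (rule compact_closure_conv_values[OF ab f K])
  have inW: "conv a (f n) t \<in> closure W" if "t \<in> {a..b}" for n t
    using that closure_subset[of W] by (auto simp: W_def)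
  have equi: "\<exists>d>0. \<forall>n. \<forall>s\<in>{a..b}. \<forall>t\<in>{a..b}. \<bar>s - t\<bar> < d \<longrightarrow> dist (conv a (f n) s) (conv a (f n) t) < e"
    if "e > 0" for e
    using conv_equicontinuous[of a b UNIV f K e] ab f K that by simp
  show thesis by (rule equicontinuous_compact_subsequence[OF ab W inW equi that])
qed

end

section \<open>Mild solutions\<close>

lemma clamp_bounds: "r \<ge> 0 \<Longrightarrow> clamp r \<theta> \<in> {-r..0}"
  by (auto simp: clamp_def)

lemma clamp_id: "\<theta> \<in> {-r..0} \<Longrightarrow> clamp r \<theta> = \<theta>"
  by (auto simp: clamp_def)

text \<open>\<open>Bcontfun\<close> can be inverted only on bounded continuous functions. Continuity
  of \<open>u\<close> on the compact window supplies both properties, since the clamped argument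
  never leaves it.\<close>

lemma apply_hist:
  fixes u :: "real \<Rightarrow> 'a::real_normed_vector"
  assumes "r \<ge> 0" "continuous_on {t - r..t} u"
  shows "apply_bcontfun (hist r u t) \<theta> = u (t + clamp r \<theta>)"
proof -
  have sub: "range (\<lambda>\<theta>. t + clamp r \<theta>) \<subseteq> {t - r..t}" using clamp_bounds[OF assms(1)] by auto
  have "continuous_on UNIV (\<lambda>\<theta>. u (t + clamp r \<theta>))"
    unfolding clamp_def
    by (rule continuous_on_compose2[OF assms(2)]) (use sub in \<open>auto simp: clamp_def intro!: continuous_intros\<close>)
  moreover have "bounded (u ` {t - r..t})"
    using assms(2) by (intro compact_imp_bounded compact_continuous_image) auto
  then have "bounded (range (\<lambda>\<theta>. u (t + clamp r \<theta>)))"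
    by (rule bounded_subset) (use sub in auto)
  ultimately have "(\<lambda>\<theta>. u (t + clamp r \<theta>)) \<in> bcontfun" by (simp add: bcontfun_def)
  then show ?thesis by (simp add: hist_def Bcontfun_inverse)
qed

lemma hist_in_Cspace:
  assumes "r \<ge> 0" "continuous_on {t - r..t} u"
  shows "hist r u t \<in> Cspace r"
  unfolding Cspace_def mem_Collect_eq apply_hist[OF assms] clamp_id[OF clamp_bounds[OF assms(1)]]
  by simp

lemma hist_cong:
  assumes "r \<ge> 0" "\<And>s. s \<in> {t - r..t} \<Longrightarrow> u s = v s"
  shows "hist r u t = hist r v t"
proof -
  have "u (t + clamp r \<theta>) = v (t + clamp r \<theta>)" for \<theta>
    using clamp_bounds[OF assms(1), of \<theta>] by (intro assms(2)) auto
  then show ?thesis by (simp add: hist_def)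
qed

lemma dist_hist_le:
  assumes "r \<ge> 0" "continuous_on {t - r..t} u" "continuous_on {t' - r..t'} u'"
    and "\<And>\<theta>. \<theta> \<in> {-r..0} \<Longrightarrow> dist (u (t + \<theta>)) (u' (t' + \<theta>)) \<le> e"
  shows "dist (hist r u t) (hist r u' t') \<le> e"
  by (rule dist_bound)
    (simp only: apply_hist[OF assms(1,2)] apply_hist[OF assms(1,3)] assms(4)[OF clamp_bounds[OF assms(1)]])

lemma continuous_on_atMost_oscillation:
  fixes u :: "real \<Rightarrow> 'a::real_normed_vector"
  assumes "continuous_on {..b} u" "e > 0"
  obtains d where "d > 0" "\<And>s t. s \<in> {c..b} \<Longrightarrow> t \<in> {c..b} \<Longrightarrow> \<bar>s - t\<bar> < d \<Longrightarrow> dist (u s) (u t) \<le> e"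
proof -
  have "continuous_on {c..b} u" using assms(1) by (rule continuous_on_subset) auto
  from continuous_on_interval_oscillation[OF this assms(2)] obtain d where
    d: "d > 0" "\<And>s t. s \<in> {c..b} \<Longrightarrow> t \<in> {c..b} \<Longrightarrow> \<bar>s - t\<bar> < 2 * d \<Longrightarrow> norm (u s - u t) \<le> e"
    by blast
  show thesis by (rule that[of "2 * d"]) (use d in \<open>auto simp: dist_norm\<close>)
qed

lemma continuous_on_hist:
  assumes "r \<ge> 0" and u: "continuous_on {a - r..b} u"
  shows "continuous_on {a..b} (hist r u)"
  unfolding continuous_on_iff
proof (intro ballI allI impI)
  fix t e :: real assume t: "t \<in> {a..b}" and e: "e > 0"
  obtain d where d: "d > 0" "\<And>s t. s \<in> {a - r..b} \<Longrightarrow> t \<in> {a - r..b} \<Longrightarrow> \<bar>s - t\<bar> < 2 * d \<Longrightarrow> norm (u s - u t) \<le> e / 2"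
    using continuous_on_interval_oscillation[OF u, of "e / 2"] e by auto
  have "dist (hist r u t') (hist r u t) < e" if t': "t' \<in> {a..b}" "dist t' t < d" for t'
  proof -
    have "dist (hist r u t') (hist r u t) \<le> e / 2"
    proof (rule dist_hist_le[OF assms(1)])
      show "continuous_on {t' - r..t'} u" "continuous_on {t - r..t} u"
        using t t' by (auto intro!: continuous_on_subset[OF u])
      fix \<theta> assume "\<theta> \<in> {-r..0}"
      then show "dist (u (t' + \<theta>)) (u (t + \<theta>)) \<le> e / 2"
        unfolding dist_norm using t t' d(1) by (intro d(2)) (auto simp: dist_real_def)
    qed
    then show ?thesis using e by simp
  qed
  then show "\<exists>d>0. \<forall>t'\<in>{a..b}. dist t' t < d \<longrightarrow> dist (hist r u t') (hist r u t) < e"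
    using d(1) by blast
qed

text \<open>A Lebesgue number argument in which y need only lie in \<open>D\<close>. The
  approximating histories lie off the compact curve of the limit, so uniform continuity on that
  curve alone could not compare them with it.\<close>

lemma continuous_on_near_compact:
  fixes F :: "'a::metric_space \<Rightarrow> 'b::metric_space"
  assumes F: "continuous_on D F" and C: "compact C" "C \<subseteq> D" and e: "e > 0"
  obtains d where "d > 0" "\<And>x y. x \<in> C \<Longrightarrow> y \<in> D \<Longrightarrow> dist x y < d \<Longrightarrow> dist (F x) (F y) < e"
proof -
  have "\<exists>d>0. \<forall>y\<in>D. dist y c < d \<longrightarrow> dist (F y) (F c) < e / 2" if "c \<in> C" for c
    using F C(2) that e unfolding continuous_on_iff by (meson half_gt_zero subsetD)
  then obtain \<rho> where \<rho>: "\<And>c. c \<in> C \<Longrightarrow> \<rho> c > 0"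
    "\<And>c y. c \<in> C \<Longrightarrow> y \<in> D \<Longrightarrow> dist y c < \<rho> c \<Longrightarrow> dist (F y) (F c) < e / 2"
    by metis
  have "C \<subseteq> \<Union> ((\<lambda>c. ball c (\<rho> c)) ` C)"
  proof
    fix c assume "c \<in> C"
    then show "c \<in> \<Union> ((\<lambda>c. ball c (\<rho> c)) ` C)" using \<rho>(1)[of c] by (intro UN_I[of c]) auto
  qed
  from Heine_Borel_lemma[OF C(1) this] obtain d where d: "d > 0"
    "\<And>x. x \<in> C \<Longrightarrow> \<exists>c\<in>C. ball x d \<subseteq> ball c (\<rho> c)"
    by (metis (no_types, lifting) image_iff open_ball)
  show thesis
  proof (rule that[OF d(1)])
    fix x y assume xy: "x \<in> C" "y \<in> D" "dist x y < d"
    obtain c where c: "c \<in> C" "ball x d \<subseteq> ball c (\<rho> c)" using d(2)[OF xy(1)] by blast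
    then have "dist x c < \<rho> c" "dist y c < \<rho> c"
      using xy d(1) by (auto simp: subset_eq dist_commute)
    then have "dist (F x) (F c) < e / 2" "dist (F y) (F c) < e / 2"
      using \<rho>(2) c xy C(2) by auto
    then show "dist (F x) (F y) < e" by (rule dist_triangle_half_l)
  qed
qed

section \<open>Existence of mild solutions\<close>

context compact_quasicontractive_semigroup
begin

text \<open>The right-hand side at t sees \<open>u\<close> only up to t - \<delta>. Each application
  of the map \<Phi> therefore settles one more interval of length \<delta>, and a finite iterate is
  an exact fixed point on {..b}.\<close>

lemma delayed_equation_solution:
  fixes B :: "real \<Rightarrow> (real \<Rightarrow>\<^sub>C 'a) \<Rightarrow> 'a" and \<phi> :: "real \<Rightarrow>\<^sub>C 'a"
  assumes r: "r > 0" and ab: "a < b" and \<delta>: "\<delta> > 0"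
    and B: "continuous_on (UNIV \<times> Cspace r) (\<lambda>(t, \<psi>). B t \<psi>)"
  obtains u where "continuous_on {..b} u" "\<And>t. t \<le> a \<Longrightarrow> u t = \<phi> (t - a)"
    "\<And>t. a \<le> t \<Longrightarrow> t \<le> b \<Longrightarrow> u t = S (t - a) (\<phi> 0) + conv a (\<lambda>s. B s (hist r u (s - \<delta>))) t"
proof -
  \<comment> \<open>Prescribing \<open>u\<close> for all t \<le> a provides the histories at times s
    - \<delta>, which reach back to a - \<delta> - r.\<close>
  define \<Phi> where "\<Phi> u t = (if t \<le> a then \<phi> (t - a)
    else S (t - a) (\<phi> 0) + conv a (\<lambda>s. B s (hist r u (s - \<delta>))) t)" for u t
  have conv_a: "conv a f a = 0" for f by (simp add: conv_def)
  have cont_f: "continuous_on {a..b} (\<lambda>s. B s (hist r u (s - \<delta>)))" if u: "continuous_on {..b} u" for u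
  proof -
    have "continuous_on {a - \<delta>..b} (hist r u)"
      using r u by (intro continuous_on_hist) (auto elim: continuous_on_subset)
    then have "continuous_on {a..b} (\<lambda>s. hist r u (s - \<delta>))"
      by (rule continuous_on_compose2) (use \<delta> in \<open>auto intro!: continuous_intros\<close>)
    then have "continuous_on {a..b} (\<lambda>s. (s, hist r u (s - \<delta>)))" by (intro continuous_intros)
    moreover have "hist r u (s - \<delta>) \<in> Cspace r" if "s \<in> {a..b}" for s
      using r that \<delta> by (intro hist_in_Cspace continuous_on_subset[OF u]) auto
    ultimately have "continuous_on {a..b} (\<lambda>s. case (s, hist r u (s - \<delta>)) of (t, \<psi>) \<Rightarrow> B t \<psi>)"
      by (intro continuous_on_compose2[OF B]) auto
    then show ?thesis by simp
  qed
  have cont_\<Phi>: "continuous_on {..b} (\<Phi> u)" if u: "continuous_on {..b} u" for u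
  proof -
    have "continuous_on ({..a} \<union> {a..b}) (\<lambda>t. if t \<le> a then \<phi> (t - a)
      else S (t - a) (\<phi> 0) + conv a (\<lambda>s. B s (hist r u (s - \<delta>))) t)"
    proof (rule continuous_on_cases)
      show "continuous_on {..a} (\<lambda>t. \<phi> (t - a))"
        by (rule continuous_on_compose2[OF continuous_on_apply_bcontfun[of UNIV]]) (auto intro!: continuous_intros)
      show "continuous_on {a..b} (\<lambda>t. S (t - a) (\<phi> 0) + conv a (\<lambda>s. B s (hist r u (s - \<delta>))) t)"
        using ab by (intro continuous_intros continuous_on_S_apply continuous_on_conv cont_f[OF u]) auto
    qed (auto simp: S_0 conv_a)
    moreover have "{..a} \<union> {a..b} = {..b}" using ab by auto
    ultimately show ?thesis by (simp add: \<Phi>_def[abs_def])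
  qed
  define U where "U k = (\<Phi> ^^ k) (\<lambda>t. \<phi> (t - a))" for k
  have cont_U: "continuous_on {..b} (U k)" for k
  proof (induction k)
    case 0
    show ?case unfolding U_def funpow.simps id_apply
      by (rule continuous_on_compose2[OF continuous_on_apply_bcontfun[of UNIV]]) (auto intro!: continuous_intros)
  next
    case (Suc k)
    then show ?case using cont_\<Phi> by (simp add: U_def)
  qed
  have agree: "U (Suc k) t = U k t" if "t \<le> b" "t \<le> a + real k * \<delta>" for k t
    using that
  proof (induction k arbitrary: t)
    case 0
    then show ?case by (simp add: U_def \<Phi>_def)
  next
    case (Suc k)
    have "B s (hist r (U (Suc k)) (s - \<delta>)) = B s (hist r (U k) (s - \<delta>))" if "s \<in> {a..t}" for s
    proof -
      have "U (Suc k) s' = U k s'" if "s' \<in> {s - \<delta> - r..s - \<delta>}" for s'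
        using Suc.prems that \<open>s \<in> {a..t}\<close> \<delta> by (intro Suc.IH) (auto simp: algebra_simps)
      then show ?thesis using r hist_cong[of r "s - \<delta>" "U (Suc k)" "U k"] by simp
    qed
    then have "conv a (\<lambda>s. B s (hist r (U (Suc k)) (s - \<delta>))) t = conv a (\<lambda>s. B s (hist r (U k) (s - \<delta>))) t"
      unfolding conv_def by (intro integral_cong) simp
    moreover have "U (Suc k') = \<Phi> (U k')" for k' by (simp add: U_def)
    ultimately show ?case by (metis \<Phi>_def)
  qed
  \<comment> \<open>N \<delta> exceeds b - a, so the N-th iterate is settled on all of
    {..b}.\<close>
  obtain N :: nat where N: "(b - a) / \<delta> < real N" using reals_Archimedean2 by blast
  have fixp: "U N t = \<Phi> (U N) t" if "t \<le> b" for t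
  proof -
    have "b \<le> a + real N * \<delta>" using N \<delta> by (simp add: field_simps)
    then have "U (Suc N) t = U N t" using that by (intro agree) auto
    then show ?thesis by (simp add: U_def)
  qed
  show thesis
  proof (rule that[OF cont_U])
    show "U N t = \<phi> (t - a)" if "t \<le> a" for t
      using fixp[of t] that ab by (simp add: \<Phi>_def)
    show "U N t = S (t - a) (\<phi> 0) + conv a (\<lambda>s. B s (hist r (U N) (s - \<delta>))) t" if "a \<le> t" "t \<le> b" for t
      using fixp[of t] that ab by (cases "t = a") (auto simp: \<Phi>_def S_0 conv_a)
  qed
qed

lemma mild_solution_bounded:
  fixes B :: "real \<Rightarrow> (real \<Rightarrow>\<^sub>C 'a) \<Rightarrow> 'a" and \<phi> :: "real \<Rightarrow>\<^sub>C 'a"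
  assumes r: "r > 0" and ab: "a < b"
    and B: "continuous_on (UNIV \<times> Cspace r) (\<lambda>(t, \<psi>). B t \<psi>)"
    and K: "\<And>t \<psi>. \<psi> \<in> Cspace r \<Longrightarrow> norm (B t \<psi>) \<le> K"
  shows "\<exists>u. mild_solution S B r a \<phi> b u"
proof -
  define \<delta> where "\<delta> n = 1 / real (Suc n)" for n
  have \<delta>: "\<delta> n > 0" for n by (simp add: \<delta>_def)
  define P where "P n u \<longleftrightarrow> continuous_on {..b} u \<and> (\<forall>t\<le>a. u t = \<phi> (t - a)) \<and>
    (\<forall>t. a \<le> t \<longrightarrow> t \<le> b \<longrightarrow> u t = S (t - a) (\<phi> 0) + conv a (\<lambda>s. B s (hist r u (s - \<delta> n))) t)" for n u
  have "\<exists>u. P n u" for n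
    by (rule delayed_equation_solution[OF r ab \<delta>[of n] B, of \<phi>]) (auto simp: P_def)
  then obtain u where u: "\<And>n. P n (u n)" by metis
  have cu: "\<And>n. continuous_on {..b} (u n)"
    and u1: "\<And>n t. t \<le> a \<Longrightarrow> u n t = \<phi> (t - a)"
    and u2: "\<And>n t. a \<le> t \<Longrightarrow> t \<le> b \<Longrightarrow> u n t = S (t - a) (\<phi> 0) + conv a (\<lambda>s. B s (hist r (u n) (s - \<delta> n))) t"
    using u unfolding P_def by blast+
  \<comment> \<open>Time and history are paired because \<open>B\<close> is continuous jointly, on
    the product.\<close>
  define z where "z n s = (s, hist r (u n) (s - \<delta> n))" for n and s :: real
  define f where "f n s = B s (hist r (u n) (s - \<delta> n))" for n s
  have f_z: "f n s = (case z n s of (t, \<psi>) \<Rightarrow> B t \<psi>)" for n s by (simp add: f_def z_def)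
  have z_in: "z n s \<in> UNIV \<times> Cspace r" if "s \<le> b" for n s
    unfolding z_def using r that \<delta>[of n] by (auto intro!: hist_in_Cspace continuous_on_subset[OF cu])
  have cont_f: "continuous_on {a..b} (f n)" for n
  proof -
    have "continuous_on {a - \<delta> n..b} (hist r (u n))"
      using r by (intro continuous_on_hist continuous_on_subset[OF cu]) auto
    then have "continuous_on {a..b} (\<lambda>s. hist r (u n) (s - \<delta> n))"
      by (rule continuous_on_compose2) (use \<delta>[of n] in \<open>auto intro!: continuous_intros\<close>)
    then have "continuous_on {a..b} (z n)" unfolding z_def by (intro continuous_intros)
    then show ?thesis unfolding f_z
      by (rule continuous_on_compose2[OF B]) (intro image_subsetI z_in, simp)
  qed
  have f_le: "norm (f n s) \<le> K" if "s \<in> {a..b}" for n s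
    using z_in[of s n] that by (auto simp: f_def z_def intro!: K)
  obtain k :: "nat \<Rightarrow> nat" and l where k: "strict_mono k"
    and l: "uniform_limit {a..b} (\<lambda>n. conv a (f (k n))) l sequentially"
    using conv_convergent_subsequence[of a b f K] ab cont_f f_le by auto
  \<comment> \<open>The values up to \<open>a\<close> and the summand S (t - a) (\<phi> 0) are the
    same for every approximant, so convergence of the convolutions is enough.\<close>
  define U where "U t = (if t \<le> a then \<phi> (t - a) else S (t - a) (\<phi> 0) + l t)" for t
  have ulim: "uniform_limit {..b} (\<lambda>n. u (k n)) U sequentially"
  proof (rule uniform_limitI)
    fix e :: real assume "e > 0"
    from uniform_limitD[OF l this] show "\<forall>\<^sub>F n in sequentially. \<forall>t\<in>{..b}. dist (u (k n) t) (U t) < e"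
    proof eventually_elim
      case (elim n)
      show ?case
      proof
        fix t assume "t \<in> {..b}"
        then show "dist (u (k n) t) (U t) < e"
          using elim \<open>e > 0\<close> by (cases "t \<le> a") (auto simp: U_def u1 u2 f_def[abs_def])
      qed
    qed
  qed
  have cU: "continuous_on {..b} U"
    by (rule uniform_limit_theorem[OF _ ulim]) (auto intro: always_eventually cu)
  define Z where "Z s = (s, hist r U s)" for s
  have cZ: "continuous_on {a..b} Z"
    unfolding Z_def using r by (intro continuous_intros continuous_on_hist continuous_on_subset[OF cU]) auto
  have Z_in: "Z s \<in> UNIV \<times> Cspace r" if "s \<in> {a..b}" for s
    unfolding Z_def using r that by (auto intro!: hist_in_Cspace continuous_on_subset[OF cU])
  \<comment> \<open>The delay is absorbed by the modulus of continuity of the limit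
    \<open>U\<close>: the approximant at the delayed time is compared with \<open>U\<close> at the
    same time, and only then is the delay removed.\<close>
  have zlim: "\<forall>\<^sub>F n in sequentially. \<forall>s\<in>{a..b}. dist (Z s) (z (k n) s) < e" if "e > 0" for e
  proof -
    have e3: "e / 3 > 0" using that by simp
    \<comment> \<open>The left end a - r - 1 leaves room for a delay of at most 1 on top of the
      history length.\<close>
    obtain d where d: "d > 0"
      "\<And>s t. s \<in> {a - r - 1..b} \<Longrightarrow> t \<in> {a - r - 1..b} \<Longrightarrow> \<bar>s - t\<bar> < d \<Longrightarrow> dist (U s) (U t) \<le> e / 3"
      using continuous_on_atMost_oscillation[OF cU e3, of "a - r - 1"] by blast
    have "\<delta> \<longlonglongrightarrow> 0" unfolding \<delta>_def by (rule LIMSEQ_Suc[OF lim_1_over_n])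
    then have "(\<lambda>n. \<delta> (k n)) \<longlonglongrightarrow> 0" using LIMSEQ_subseq_LIMSEQ[OF _ k] by (simp add: o_def)
    then have "\<forall>\<^sub>F n in sequentially. \<delta> (k n) < d" using d(1) by (rule order_tendstoD(2))
    with uniform_limitD[OF ulim e3] show ?thesis
    proof eventually_elim
      case (elim n)
      have \<delta>1: "\<delta> (k n) \<le> 1" by (simp add: \<delta>_def)
      show ?case
      proof
        fix s assume s: "s \<in> {a..b}"
        have "dist (hist r U s) (hist r (u (k n)) (s - \<delta> (k n))) \<le> e / 3 + e / 3"
        proof (rule dist_hist_le)
          show "continuous_on {s - r..s} U" using s by (auto intro: continuous_on_subset[OF cU])
          show "continuous_on {s - \<delta> (k n) - r..s - \<delta> (k n)} (u (k n))"
            using s \<delta>[of "k n"] by (auto intro!: continuous_on_subset[OF cu])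
          fix \<theta> assume \<theta>: "\<theta> \<in> {-r..0}"
          have "dist (U (s + \<theta>)) (U (s - \<delta> (k n) + \<theta>)) \<le> e / 3"
            using s \<theta> \<delta>[of "k n"] \<delta>1 elim by (intro d(2)) auto
          moreover have "dist (u (k n) (s - \<delta> (k n) + \<theta>)) (U (s - \<delta> (k n) + \<theta>)) < e / 3"
            using s \<theta> \<delta>[of "k n"] by (intro elim(1)[rule_format]) auto
          ultimately show "dist (U (s + \<theta>)) (u (k n) (s - \<delta> (k n) + \<theta>)) \<le> e / 3 + e / 3"
            using dist_triangle2[of "U (s + \<theta>)" "u (k n) (s - \<delta> (k n) + \<theta>)" "U (s - \<delta> (k n) + \<theta>)"]
            by linarith
        qed (use r in simp)
        then show "dist (Z s) (z (k n) s) < e" using that by (simp add: Z_def z_def dist_Pair_Pair)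
      qed
    qed
  qed
  define F where "F s = B s (hist r U s)" for s
  have F_Z: "F s = (case Z s of (t, \<psi>) \<Rightarrow> B t \<psi>)" for s by (simp add: F_def Z_def)
  have flim: "uniform_limit {a..b} (\<lambda>n. f (k n)) F sequentially"
  proof (rule uniform_limitI)
    fix e :: real assume e: "e > 0"
    have cpt: "compact (Z ` {a..b})" by (intro compact_continuous_image cZ) auto
    have sub: "Z ` {a..b} \<subseteq> UNIV \<times> Cspace r" by (intro image_subsetI Z_in)
    obtain d where d: "d > 0" "\<And>x y. x \<in> Z ` {a..b} \<Longrightarrow> y \<in> UNIV \<times> Cspace r \<Longrightarrow> dist x y < d \<Longrightarrow>
        dist (case x of (t, \<psi>) \<Rightarrow> B t \<psi>) (case y of (t, \<psi>) \<Rightarrow> B t \<psi>) < e"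
      using continuous_on_near_compact[OF B cpt sub e] by blast
    from zlim[OF d(1)] show "\<forall>\<^sub>F n in sequentially. \<forall>s\<in>{a..b}. dist (f (k n) s) (F s) < e"
    proof eventually_elim
      case (elim n)
      show ?case
      proof
        fix s assume s: "s \<in> {a..b}"
        have "dist (F s) (f (k n) s) < e" unfolding F_Z f_z
          using elim s by (intro d(2) z_in imageI) auto
        then show "dist (f (k n) s) (F s) < e" by (simp add: dist_commute)
      qed
    qed
  qed
  have int: "((\<lambda>s. S (t - s) (F s)) has_integral l t) {a..t}" if t: "a \<le> t" "t \<le> b" for t
  proof -
    define E where "E = exp (\<bar>\<omega>\<bar> * (b - a))"
    have E: "E > 0" by (simp add: E_def)
    have "uniform_limit {a..t} (\<lambda>n s. S (t - s) (f (k n) s)) (\<lambda>s. S (t - s) (F s)) sequentially"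
    proof (rule uniform_limitI)
      fix e :: real assume "e > 0"
      then have "e / E > 0" using E by simp
      from uniform_limitD[OF flim this]
      show "\<forall>\<^sub>F n in sequentially. \<forall>s\<in>{a..t}. dist (S (t - s) (f (k n) s)) (S (t - s) (F s)) < e"
      proof eventually_elim
        case (elim n)
        show ?case
        proof
          fix s assume s: "s \<in> {a..t}"
          have "dist (S (t - s) (f (k n) s)) (S (t - s) (F s)) = norm (S (t - s) (f (k n) s - F s))"
            by (simp add: dist_norm blinfun.diff_right)
          also have "\<dots> \<le> E * norm (f (k n) s - F s)"
            unfolding E_def using s t by (intro norm_S_apply_le) auto
          also have "\<dots> < e" using elim s t E by (auto simp: dist_norm field_simps)
          finally show "dist (S (t - s) (f (k n) s)) (S (t - s) (F s)) < e" .
        qed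
      qed
    qed
    moreover have "continuous_on {a..t} (\<lambda>s. S (t - s) (f (k n) s))" for n
      using t by (intro continuous_on_conv_integrand[OF cont_f]) auto
    ultimately obtain I J where I: "\<And>n. ((\<lambda>s. S (t - s) (f (k n) s)) has_integral I n) {a..t}"
      and J: "((\<lambda>s. S (t - s) (F s)) has_integral J) {a..t}" and IJ: "I \<longlonglongrightarrow> J"
      by (rule uniform_limit_integral) auto
    have "I n = conv a (f (k n)) t" for n
      unfolding conv_def by (rule integral_unique[OF I, symmetric])
    then have "I = (\<lambda>n. conv a (f (k n)) t)" by (rule ext)
    moreover have "(\<lambda>n. conv a (f (k n)) t) \<longlonglongrightarrow> l t"
      using t by (intro tendsto_uniform_limitI[OF l]) auto
    ultimately have "J = l t" using IJ LIMSEQ_unique by blast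
    then show ?thesis using J by simp
  qed
  have "mild_solution S B r a \<phi> b U"
    unfolding mild_solution_def
  proof (intro conjI ballI)
    show "continuous_on {a - r..b} U" by (rule continuous_on_subset[OF cU]) auto
    show "U (a + \<theta>) = \<phi> \<theta>" if "\<theta> \<in> {-r..0}" for \<theta> using that by (simp add: U_def)
    fix t assume t: "t \<in> {a..b}"
    \<comment> \<open>The degenerate interval gives l a = 0, which reconciles the two branches of
      \<open>U\<close> at t = a.\<close>
    have "((\<lambda>s. S (a - s) (F s)) has_integral l a) {a}" using int[of a] ab by simp
    then have "l a = 0" using has_integral_refl(2) by (rule has_integral_unique)
    then have "U t - S (t - a) (\<phi> 0) = l t" using t by (auto simp: U_def S_0)
    then show "((\<lambda>s. S (t - s) (B s (hist r U s))) has_integral U t - S (t - a) (\<phi> 0)) {a..t}"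
      using int[of t] t by (simp add: F_def)
  qed
  then show ?thesis by blast
qed

text \<open>The truncated equation has a solution up to a + 1. Its histories form a continuous curve
  starting at \<phi>, so \<open>B\<close> along it stays below the truncation level for a short
  time, during which both equations agree.\<close>

lemma mild_solution_local:
  fixes B :: "real \<Rightarrow> (real \<Rightarrow>\<^sub>C 'a) \<Rightarrow> 'a" and \<phi> :: "real \<Rightarrow>\<^sub>C 'a"
  assumes r: "r > 0" and \<phi>: "\<phi> \<in> Cspace r"
    and B: "continuous_on (UNIV \<times> Cspace r) (\<lambda>(t, \<psi>). B t \<psi>)"
  shows "\<exists>T>a. \<exists>u. mild_solution S B r a \<phi> T u"
proof -
  \<comment> \<open>The extra 1 leaves strict room above norm (B a \<phi>), so that by continuity
    the bound persists for a while.\<close>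
  define K where "K = norm (B a \<phi>) + 1"
  have K: "K > 0" by (simp add: K_def add_nonneg_pos)
  \<comment> \<open>Radial truncation: \<open>B'\<close> is globally bounded and agrees with \<open>B\<close> near \<open>(a, \<phi>)\<close>.\<close>
  define m where "m t \<psi> = max 1 (norm (B t \<psi>) / K)" for t \<psi>
  define B' where "B' t \<psi> = (1 / m t \<psi>) *\<^sub>R B t \<psi>" for t \<psi>
  have m: "m t \<psi> \<ge> 1" for t \<psi> by (simp add: m_def)
  have "continuous_on (UNIV \<times> Cspace r) (\<lambda>z. (1 / max 1 (norm (case z of (t, \<psi>) \<Rightarrow> B t \<psi>) / K)) *\<^sub>R (case z of (t, \<psi>) \<Rightarrow> B t \<psi>))"
    by (intro continuous_intros B) (use K in \<open>auto simp: max_def\<close>)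
  then have cB': "continuous_on (UNIV \<times> Cspace r) (\<lambda>(t, \<psi>). B' t \<psi>)"
    by (simp add: B'_def m_def case_prod_unfold)
  have B'_le: "norm (B' t \<psi>) \<le> K" for t \<psi>
  proof -
    have "norm (B t \<psi>) \<le> K * m t \<psi>" using K by (simp add: m_def max_def field_simps)
    then show ?thesis using m[of t \<psi>] by (simp add: B'_def field_simps)
  qed
  obtain u where u: "mild_solution S B' r a \<phi> (a + 1) u"
    using mild_solution_bounded[OF r _ cB' B'_le, of a "a + 1" \<phi>] by auto
  have cu: "continuous_on {a - r..a + 1} u" and u0: "\<And>\<theta>. \<theta> \<in> {-r..0} \<Longrightarrow> u (a + \<theta>) = \<phi> \<theta>"
    using u by (auto simp: mild_solution_def)
  \<comment> \<open>The history records the values of \<phi> on [-r,0] only; membership in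
    \<open>Cspace r\<close> says that these determine \<phi>.\<close>
  have "hist r u a = \<phi>"
  proof (rule bcontfun_eqI)
    fix \<theta>
    have "hist r u a \<theta> = u (a + clamp r \<theta>)"
      using r by (intro apply_hist continuous_on_subset[OF cu]) auto
    also have "\<dots> = \<phi> (clamp r \<theta>)" using r by (intro u0 clamp_bounds) simp
    also have "\<dots> = \<phi> \<theta>" using \<phi> unfolding Cspace_def by simp
    finally show "hist r u a \<theta> = \<phi> \<theta>" .
  qed
  moreover have cBu: "continuous_on {a..a + 1} (\<lambda>s. norm (case (s, hist r u s) of (t, \<psi>) \<Rightarrow> B t \<psi>))"
  proof (rule continuous_on_norm, rule continuous_on_compose2[OF B])
    show "continuous_on {a..a + 1} (\<lambda>s. (s, hist r u s))"
      using r by (intro continuous_intros continuous_on_hist cu) auto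
    show "(\<lambda>s. (s, hist r u s)) ` {a..a + 1} \<subseteq> UNIV \<times> Cspace r"
      using r by (auto intro!: hist_in_Cspace continuous_on_subset[OF cu])
  qed
  ultimately have lim: "((\<lambda>s. norm (B s (hist r u s))) \<longlongrightarrow> norm (B a \<phi>)) (at a within {a..a + 1})"
    unfolding continuous_on_def by fastforce
  have "\<forall>\<^sub>F s in at a within {a..a + 1}. norm (B s (hist r u s)) < K"
    by (rule order_tendstoD(2)[OF lim]) (simp add: K_def)
  then obtain d where d: "d > 0" "\<And>s. s \<in> {a..a + 1} \<Longrightarrow> s \<noteq> a \<Longrightarrow> dist s a < d \<Longrightarrow> norm (B s (hist r u s)) < K"
    unfolding eventually_at by blast
  \<comment> \<open>Halving d keeps [a,T] strictly within distance d of \<open>a\<close>; the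
    minimum keeps T in the interval on which \<open>u\<close> is known.\<close>
  define T where "T = a + min 1 (d / 2)"
  have T: "a < T" "T \<le> a + 1" using d(1) by (auto simp: T_def)
  have eq: "B' s (hist r u s) = B s (hist r u s)" if "s \<in> {a..T}" for s
  proof -
    have "norm (B s (hist r u s)) \<le> K"
    proof (cases "s = a")
      case True
      then show ?thesis using \<open>hist r u a = \<phi>\<close> by (simp add: K_def)
    next
      case False
      then show ?thesis using that d(1) by (intro less_imp_le d(2)) (auto simp: T_def dist_real_def)
    qed
    then have "m s (hist r u s) = 1" using K by (simp add: m_def)
    then show ?thesis by (simp add: B'_def)
  qed
  have "mild_solution S B r a \<phi> T u"
    unfolding mild_solution_def
  proof (intro conjI ballI)
    show "continuous_on {a - r..T} u" using T by (intro continuous_on_subset[OF cu]) auto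
    show "u (a + \<theta>) = \<phi> \<theta>" if "\<theta> \<in> {-r..0}" for \<theta> using u0[OF that] .
    fix t assume t: "t \<in> {a..T}"
    then have "((\<lambda>s. S (t - s) (B' s (hist r u s))) has_integral (u t - S (t - a) (\<phi> 0))) {a..t}"
      using u T by (auto simp: mild_solution_def)
    then show "((\<lambda>s. S (t - s) (B s (hist r u s))) has_integral (u t - S (t - a) (\<phi> 0))) {a..t}"
      by (rule has_integral_eq[rotated]) (use eq t in auto)
  qed
  then show ?thesis using T(1) by blast
qed

end

text \<open>The jump equation in \<open>A3\<close> adds up h_k over all k located at \<theta>,
  because delays may coincide; a finite list of jumps is padded by h_k = 0.\<close>

theorem theorem2:
  fixes S :: "real \<Rightarrow> ('a::banach \<Rightarrow>\<^sub>L 'a)"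
    and \<omega> r a L\<^sub>p C\<^sub>1 C\<^sub>2 M\<^sub>V\<^sub>g :: real
    and G :: "real \<Rightarrow> 'a \<Rightarrow> 'a \<Rightarrow> 'a"
    and p :: "real \<Rightarrow> 'a \<Rightarrow> 'a"
    and g :: "real \<Rightarrow> real \<Rightarrow> (real \<Rightarrow>\<^sub>C 'a) \<Rightarrow> real"
  assumes r_pos: "r > 0"
    and semigroup: "compact_semigroup S"
    and growth: "\<And>t. t \<ge> 0 \<Longrightarrow> norm (S t) \<le> exp (\<omega> * t)"
    and G_cont: "continuous_on UNIV (\<lambda>(t, x, y). G t x y)"
    and Lp: "L\<^sub>p \<ge> 0"
    and p_lip: "\<And>t u s v. norm (p t u - p s v) \<le> L\<^sub>p * (\<bar>s - t\<bar> + norm (u - v))"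
    and C12: "C\<^sub>1 \<ge> 0" "C\<^sub>2 \<ge> 0"
    and p_bound: "\<And>s u. norm (p s u) \<le> C\<^sub>1 * norm u + C\<^sub>2"
    and A1: "M\<^sub>V\<^sub>g > 0"
      "\<And>t \<phi>. \<phi> \<in> Cspace r \<Longrightarrow> bounded_variation_on (\<lambda>\<theta>. g \<theta> t \<phi>) (-r) 0"
      "\<And>t \<phi>. \<phi> \<in> Cspace r \<Longrightarrow> total_variation (\<lambda>\<theta>. g \<theta> t \<phi>) (-r) 0 \<le> ereal M\<^sub>V\<^sub>g"
    and A2: "\<And>\<theta>. \<theta> \<in> {-r..0} \<Longrightarrow>
      continuous_on (UNIV \<times> Cspace r) (\<lambda>(t, \<phi>). cont_part (\<lambda>\<theta>'. g \<theta>' t \<phi>) (-r) 0 \<theta>)"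
    and A3: "\<exists>(\<eta> :: nat \<Rightarrow> real \<times> (real \<Rightarrow>\<^sub>C 'a) \<Rightarrow> real) (h :: nat \<Rightarrow> real \<times> (real \<Rightarrow>\<^sub>C 'a) \<Rightarrow> real).
      (\<forall>k. continuous_on (UNIV \<times> Cspace r) (\<eta> k) \<and> continuous_on (UNIV \<times> Cspace r) (h k)) \<and>
      (\<forall>k. \<forall>z \<in> UNIV \<times> Cspace r. \<eta> k z \<in> {0..r}) \<and>
      (\<forall>Z. Z \<subseteq> UNIV \<times> Cspace r \<and> bounded Z \<longrightarrow>
          uniformly_convergent_on Z (\<lambda>n z. \<Sum>k<n. \<bar>h k z\<bar>) \<and>
          uniformly_convergent_on Z (\<lambda>n z. \<Sum>k<n. h k z)) \<and>
      (\<forall>t. \<forall>\<phi> \<in> Cspace r. \<forall>\<theta> \<in> {-r..0}.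
          jump (jump_part (\<lambda>\<theta>'. g \<theta>' t \<phi>) (-r) 0) (-r) 0 \<theta>
            = (\<Sum>k. if - \<eta> k (t, \<phi>) = \<theta> then h k (t, \<phi>) else 0))"
  shows "\<forall>\<phi> \<in> Cspace r. \<exists>T > a. \<exists>u.
           mild_solution S
             (\<lambda>t \<psi>. G t (apply_bcontfun \<psi> 0)
                (RS_integral (\<lambda>\<theta>. p t (apply_bcontfun \<psi> \<theta>)) (\<lambda>\<theta>. g \<theta> t \<psi>) (-r) 0))
             r a \<phi> T u"
proof -
  interpret compact_quasicontractive_semigroup S \<omega>
    by unfold_locales (use semigroup growth in \<open>auto simp: compact_semigroup_def\<close>)
  let ?Z = "UNIV \<times> Cspace r :: (real \<times> (real \<Rightarrow>\<^sub>C 'a)) set"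
  obtain \<eta> h where \<eta>: "\<And>k. continuous_on ?Z (\<eta> k)" and h: "\<And>k. continuous_on ?Z (h k)"
    and \<eta>_in: "\<And>k z. z \<in> ?Z \<Longrightarrow> \<eta> k z \<in> {0..r}"
    and hsum: "\<And>Y. Y \<subseteq> ?Z \<Longrightarrow> bounded Y \<Longrightarrow> uniformly_convergent_on Y (\<lambda>n z. \<Sum>k<n. \<bar>h k z\<bar>)"
    and jumps: "\<And>t \<phi> \<theta>. \<phi> \<in> Cspace r \<Longrightarrow> \<theta> \<in> {-r..0} \<Longrightarrow>
      jump (jump_part (\<lambda>\<theta>'. g \<theta>' t \<phi>) (-r) 0) (-r) 0 \<theta>
        = (\<Sum>k. if - \<eta> k (t, \<phi>) = \<theta> then h k (t, \<phi>) else 0)"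
    using A3
  proof (elim exE conjE, goal_cases)
    case (1 \<eta> h)
    show ?case
      by (rule 1(1)[of \<eta> h]) (use 1(2) in simp, use 1(2) in simp, rule 1(3)[rule_format], assumption,
        use 1(4) in simp, use 1(5) in simp)
  qed
  define f :: "real \<times> (real \<Rightarrow>\<^sub>C 'a) \<Rightarrow> real \<Rightarrow> 'a" where "f z \<theta> = p (fst z) (snd z \<theta>)" for z \<theta>
  \<comment> \<open>This Lipschitz estimate serves twice: for fixed z it gives continuity in
    \<theta>, and for z near z0 closeness uniform in \<theta>, because the sup norm bounds the
    distance of the values.\<close>
  have f_diff: "dist (f z \<theta>) (f z' \<theta>') \<le> L\<^sub>p * (dist (fst z) (fst z') + dist (snd z \<theta>) (snd z' \<theta>'))" for z z' \<theta> \<theta>'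
    using p_lip[of "fst z" "snd z \<theta>" "fst z'" "snd z' \<theta>'"]
    by (simp add: f_def dist_norm norm_minus_commute dist_real_def abs_minus_commute)
  have f_cont: "continuous_on {-r..0} (f z)" for z
    unfolding continuous_on_def
  proof
    fix \<theta> assume "\<theta> \<in> {-r..0}"
    have "((snd z) \<longlongrightarrow> snd z \<theta>) (at \<theta> within {-r..0})"
      using continuous_on_apply_bcontfun[of "{-r..0}" "snd z"] \<open>\<theta> \<in> {-r..0}\<close> unfolding continuous_on_def by blast
    then have "((\<lambda>\<theta>'. L\<^sub>p * (dist (fst z) (fst z) + dist (snd z \<theta>') (snd z \<theta>))) \<longlongrightarrow>
        L\<^sub>p * (dist (fst z) (fst z) + dist (snd z \<theta>) (snd z \<theta>))) (at \<theta> within {-r..0})"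
      by (intro tendsto_intros)
    then have "((\<lambda>\<theta>'. L\<^sub>p * (dist (fst z) (fst z) + dist (snd z \<theta>') (snd z \<theta>))) \<longlongrightarrow> 0) (at \<theta> within {-r..0})"
      by simp
    then show "(f z \<longlongrightarrow> f z \<theta>) (at \<theta> within {-r..0})"
      unfolding tendsto_dist_iff[of "f z"]
      by (rule Lim_null_comparison[rotated]) (intro always_eventually allI, simp only: real_norm_def abs_of_nonneg[OF zero_le_dist], rule f_diff)
  qed
  have f_lim: "uniform_limit {-r..0} f (f z0) (at z0 within ?Z)" for z0
  proof (rule uniform_limitI)
    fix e :: real assume "e > 0"
    have "((\<lambda>z. L\<^sub>p * (dist (fst z) (fst z0) + dist (snd z) (snd z0))) \<longlongrightarrow>
       L\<^sub>p * (dist (fst z0) (fst z0) + dist (snd z0) (snd z0))) (at z0 within ?Z)"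
      by (intro tendsto_intros)
    then have "\<forall>\<^sub>F z in at z0 within ?Z. L\<^sub>p * (dist (fst z) (fst z0) + dist (snd z) (snd z0)) < e"
      using \<open>e > 0\<close> by (intro order_tendstoD(2)) auto
    then show "\<forall>\<^sub>F z in at z0 within ?Z. \<forall>\<theta>\<in>{-r..0}. dist (f z \<theta>) (f z0 \<theta>) < e"
    proof eventually_elim
      case (elim z)
      show ?case
      proof
        fix \<theta>
        have "L\<^sub>p * (dist (fst z) (fst z0) + dist (snd z \<theta>) (snd z0 \<theta>)) \<le> L\<^sub>p * (dist (fst z) (fst z0) + dist (snd z) (snd z0))"
          using Lp by (intro mult_left_mono add_left_mono dist_bounded)
        then show "dist (f z \<theta>) (f z0 \<theta>) < e" using elim f_diff[of z \<theta> z0 \<theta>] by linarith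
      qed
    qed
  qed
  have F: "continuous_on ?Z (\<lambda>z. RS_integral (f z) (\<lambda>\<theta>. g \<theta> (fst z) (snd z)) (-r) 0)"
  proof (rule continuous_on_RS_integral[where h = h and \<tau> = "\<lambda>k z. - \<eta> k z" and M = M\<^sub>V\<^sub>g])
    show "continuous_on ?Z (\<lambda>z. cont_part (\<lambda>\<theta>. g \<theta> (fst z) (snd z)) (-r) 0 \<theta>)" if "\<theta> \<in> {-r..0}" for \<theta>
      using A2[OF that] by (simp add: case_prod_unfold)
    show "jump (jump_part (\<lambda>\<theta>. g \<theta> (fst z) (snd z)) (-r) 0) (-r) 0 \<theta>
        = (\<Sum>k. if - \<eta> k z = \<theta> then h k z else 0)" if "z \<in> ?Z" "\<theta> \<in> {-r..0}" for z \<theta>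
      using jumps[of "snd z" \<theta> "fst z"] that by (simp only: prod.collapse mem_Times_iff)
    show "- \<eta> k z \<in> {-r..0}" if "z \<in> ?Z" for k z using \<eta>_in[OF that, of k] by auto
  qed (use r_pos f_cont f_lim A1(3) hsum h \<eta> in \<open>auto intro!: continuous_intros\<close>)
  have "continuous_on UNIV (\<lambda>\<psi> :: real \<Rightarrow>\<^sub>C 'a. \<psi> 0)"
    unfolding continuous_on_iff using dist_bounded order_le_less_trans by blast
  then have ev: "continuous_on ?Z (\<lambda>z. apply_bcontfun (snd z) 0)"
    by (rule continuous_on_compose2) (auto intro!: continuous_intros)
  have "continuous_on ?Z (\<lambda>z. (fst z, apply_bcontfun (snd z) 0, RS_integral (f z) (\<lambda>\<theta>. g \<theta> (fst z) (snd z)) (-r) 0))"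
    by (intro continuous_intros ev F)
  from continuous_on_compose2[OF G_cont this]
  have B: "continuous_on ?Z (\<lambda>(t, \<psi>). G t (apply_bcontfun \<psi> 0)
      (RS_integral (\<lambda>\<theta>. p t (apply_bcontfun \<psi> \<theta>)) (\<lambda>\<theta>. g \<theta> t \<psi>) (-r) 0))"
    by (simp add: case_prod_unfold f_def[abs_def])
  show ?thesis by (intro ballI mild_solution_local[OF r_pos _ B])
qed

end
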